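(* Let $d\ge 1$ be an integer and let $p,q$ be real numbers with $2-d\le p<0<q\le 2$. Let $K(x)=|x|^q/q-|x|^p/p$ on $\mathbb{R}^d$ and $\mathsf{E}(\mu)=\int_{\mathbb{R}^d}\int_{\mathbb{R}^d}K(x-y)\,d\mu(x)\,d\mu(y)$. Let $\varphi:\mathbb{R}^d\to\mathbb{R}$ be a mollifier satisfying: $\varphi\in C^\infty(\mathbb{R}^d)$ is radial and nonnegative; $\int_{\mathbb{R}^d}\varphi(x)\,dx=1$; and $\varphi(x)\le C|x|^{-l}$ for some $l\ge\max\{2d+1,4\}$ and $C>0$. For $\epsilon>0$ let $\varphi_\epsilon(x)=\epsilon^{-d}\varphi(x/\epsilon)$, $K_\epsilon=\varphi_\epsilon*K*\varphi_\epsilon$ and $\mathsf{E}_\epsilon(\mu)=\int_{\mathbb{R}^d}\int_{\mathbb{R}^d}K_\epsilon(x-y)\,d\mu(x)\,d\mu(y)$. Then $\{\mathsf{E}_\epsilon\}_{\epsilon>0}$ $\Gamma$-converges to $\mathsf{E}$ as $\epsilon\to0$ with respect to $(\mathcal{P}_2(\mathbb{R}^d),d_W)$; that is: (i) (Lower semicontinuity) For any $\{\mu_\epsilon\}_{\epsilon>0}\subset\mathcal{P}_2(\mathbb{R}^d)$ and $\mu\in\mathcal{P}_2(\mathbb{R}^d)$ such that $\lim_{\epsilon\to0}d_W(\mu_\epsilon,\mu)=0$, we have $\liminf_{\epsilon\to0}\mathsf{E}_\epsilon(\mu_\epsilon)\ge\mathsf{E}(\mu)$. (ii) (Recovery sequence)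 For any $\mu\in\mathcal{P}_2(\mathbb{R}^d)$ there exists $\{\nu_\epsilon\}_{\epsilon>0}\subset\mathcal{P}_2(\mathbb{R}^d)$ such that $\lim_{\epsilon\to0}d_W(\nu_\epsilon,\mu)=0$ and $\lim_{\epsilon\to0}\mathsf{E}_\epsilon(\nu_\epsilon)=\mathsf{E}(\mu)$.
   Context: $\mathcal{P}_2(\mathbb{R}^d)$ is the set of Borel probability measures on $\mathbb{R}^d$ with finite second moment, and $d_W$ is the 2-Wasserstein distance on it: $d_W(\mu,\nu)^2=\min_\gamma\int|x-y|^2\,d\gamma(x,y)$ over all couplings $\gamma$ of $\mu$ and $\nu$. The kernel $K$ takes the value $+\infty$ at $x=0$ (since $p<0$), and $\mathsf{E}$ may take the value $+\infty$. The condition $2-d\le p<0$ forces $d\ge3$. *)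

theory Defs
  imports "HOL-Probability.Probability"
begin

primrec Ck :: "nat \<Rightarrow> ('a::euclidean_space \<Rightarrow> real) \<Rightarrow> bool" where
  "Ck 0 f \<longleftrightarrow> continuous_on UNIV f"
| "Ck (Suc k) f \<longleftrightarrow> f differentiable_on UNIV \<and>
     (\<forall>b\<in>Basis. Ck k (\<lambda>x. frechet_derivative f (at x) b))"

definition smooth :: "('a::euclidean_space \<Rightarrow> real) \<Rightarrow> bool" where
  "smooth f \<longleftrightarrow> (\<forall>k. Ck k f)"

definition radial :: "('a::euclidean_space \<Rightarrow> real) \<Rightarrow> bool" where
  "radial f \<longleftrightarrow> (\<exists>g. \<forall>x. f x = g (norm x))"

definition P2 :: "'a::euclidean_space measure set" where
  "P2 = {\<mu>. sets \<mu> = sets borel \<and> prob_space \<mu> \<and>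
             (\<integral>\<^sup>+x. ennreal ((norm x)\<^sup>2) \<partial>\<mu>) < \<infinity>}"

definition couplings ::
  "'a::euclidean_space measure \<Rightarrow> 'a measure \<Rightarrow> ('a \<times> 'a) measure set" where
  "couplings \<mu> \<nu> = {\<gamma>. sets \<gamma> = sets (borel \<Otimes>\<^sub>M borel) \<and>
                      distr \<gamma> borel fst = \<mu> \<and> distr \<gamma> borel snd = \<nu>}"

definition wasserstein_cost ::
  "'a::euclidean_space measure \<Rightarrow> 'a measure \<Rightarrow> ennreal" where
  "wasserstein_cost \<mu> \<nu> =
     (INF \<gamma>\<in>couplings \<mu> \<nu>. \<integral>\<^sup>+z. ennreal ((norm (fst z - snd z))\<^sup>2) \<partial>\<gamma>)"

(* The cost is finite on P2 (lemma wasserstein_cost_finite below), so enn2real loses nothing there. *)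
definition d_W :: "'a::euclidean_space measure \<Rightarrow> 'a measure \<Rightarrow> real" where
  "d_W \<mu> \<nu> = sqrt (enn2real (wasserstein_cost \<mu> \<nu>))"

lemma wasserstein_cost_finite:
  fixes \<mu> \<nu> :: "'a::euclidean_space measure"
  assumes "\<mu> \<in> P2" "\<nu> \<in> P2"
  shows "wasserstein_cost \<mu> \<nu> < \<infinity>"
proof -
  have s [measurable_cong]: "sets \<mu> = sets borel" "sets \<nu> = sets borel"
    and p: "prob_space \<mu>" "prob_space \<nu>"
    and f: "(\<integral>\<^sup>+x. ennreal ((norm x)\<^sup>2) \<partial>\<mu>) < \<infinity>" "(\<integral>\<^sup>+x. ennreal ((norm x)\<^sup>2) \<partial>\<nu>) < \<infinity>"
    using assms by (auto simp: P2_def)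
  interpret M: prob_space \<mu> by fact
  interpret N: prob_space \<nu> by fact
  interpret pair_prob_space \<mu> \<nu> ..
  have d1: "distr (\<mu> \<Otimes>\<^sub>M \<nu>) borel fst = \<mu>"
    using N.distr_pair_fst[of \<mu>] s(1) by (metis distr_cong)
  have d2: "distr (\<mu> \<Otimes>\<^sub>M \<nu>) borel snd = \<nu>"
  proof (rule measure_eqI)
    fix A assume "A \<in> sets (distr (\<mu> \<Otimes>\<^sub>M \<nu>) borel snd)"
    then have A: "A \<in> sets \<nu>" using s by simp
    have v: "snd -` A \<inter> space (\<mu> \<Otimes>\<^sub>M \<nu>) = space \<mu> \<times> A"
      using sets.sets_into_space[OF A] by (auto simp: space_pair_measure)
    show "emeasure (distr (\<mu> \<Otimes>\<^sub>M \<nu>) borel snd) A = emeasure \<nu> A"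
      using A v s by (subst emeasure_distr)
        (auto simp: N.emeasure_pair_measure_Times M.emeasure_space_1)
  qed (use s in simp)
  have "\<mu> \<Otimes>\<^sub>M \<nu> \<in> couplings \<mu> \<nu>"
    unfolding couplings_def using d1 d2 s by (auto intro!: sets_pair_measure_cong)
  then have "wasserstein_cost \<mu> \<nu> \<le> (\<integral>\<^sup>+z. ennreal ((norm (fst z - snd z))\<^sup>2) \<partial>(\<mu> \<Otimes>\<^sub>M \<nu>))"
    unfolding wasserstein_cost_def by (rule INF_lower)
  also have "\<dots> \<le> (\<integral>\<^sup>+z. 2 * ennreal ((norm (fst z))\<^sup>2) + 2 * ennreal ((norm (snd z))\<^sup>2) \<partial>(\<mu> \<Otimes>\<^sub>M \<nu>))"
  proof (rule nn_integral_mono)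
    fix z :: "'a \<times> 'a"
    have "(norm (fst z - snd z))\<^sup>2 \<le> (norm (fst z) + norm (snd z))\<^sup>2"
      by (intro power_mono norm_triangle_ineq4) simp
    also have "\<dots> \<le> 2 * (norm (fst z))\<^sup>2 + 2 * (norm (snd z))\<^sup>2"
      using sum_squares_bound[of "norm (fst z)" "norm (snd z)"] by (simp add: power2_sum)
    finally have "ennreal ((norm (fst z - snd z))\<^sup>2) \<le>
        ennreal (2 * (norm (fst z))\<^sup>2 + 2 * (norm (snd z))\<^sup>2)"
      by (rule ennreal_leI)
    then show "ennreal ((norm (fst z - snd z))\<^sup>2) \<le>
        2 * ennreal ((norm (fst z))\<^sup>2) + 2 * ennreal ((norm (snd z))\<^sup>2)"
      by (simp add: ennreal_mult)
  qed
  also have "\<dots> = 2 * (\<integral>\<^sup>+x. ennreal ((norm x)\<^sup>2) \<partial>\<mu>) + 2 * (\<integral>\<^sup>+y. ennreal ((norm y)\<^sup>2) \<partial>\<nu>)"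
    by (subst N.nn_integral_fst[symmetric])
       (auto simp: nn_integral_add nn_integral_cmult M.emeasure_space_1 N.emeasure_space_1)
  also have "\<dots> < \<infinity>"
    using f by (simp add: ennreal_mult_less_top)
  finally show ?thesis .
qed

(* For p < 0 < q both terms of |x|^q/q - |x|^p/p are nonnegative, so the conversion to
   ennreal does not truncate; the value at 0 has to be set by hand because 0 powr p = 0. *)
definition interaction_kernel :: "real \<Rightarrow> real \<Rightarrow> 'a::euclidean_space \<Rightarrow> ennreal" where
  "interaction_kernel p q x =
     (if x = 0 then \<infinity> else ennreal (norm x powr q / q - norm x powr p / p))"

definition energy :: "('a::euclidean_space \<Rightarrow> ennreal) \<Rightarrow> 'a measure \<Rightarrow> ennreal" where
  "energy K \<mu> = (\<integral>\<^sup>+x. \<integral>\<^sup>+y. K (x - y) \<partial>\<mu> \<partial>\<mu>)"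

definition nn_convolution ::
  "('a::euclidean_space \<Rightarrow> ennreal) \<Rightarrow> ('a \<Rightarrow> ennreal) \<Rightarrow> 'a \<Rightarrow> ennreal" where
  "nn_convolution f g x = (\<integral>\<^sup>+y. f (x - y) * g y \<partial>lborel)"

definition rescale :: "('a::euclidean_space \<Rightarrow> real) \<Rightarrow> real \<Rightarrow> 'a \<Rightarrow> real" where
  "rescale \<phi> \<epsilon> x = \<phi> (x /\<^sub>R \<epsilon>) / \<epsilon> ^ DIM('a)"

definition mollified_kernel ::
  "('a::euclidean_space \<Rightarrow> real) \<Rightarrow> ('a \<Rightarrow> ennreal) \<Rightarrow> real \<Rightarrow> 'a \<Rightarrow> ennreal" where
  "mollified_kernel \<phi> K \<epsilon> =
     nn_convolution (nn_convolution (\<lambda>x. ennreal (rescale \<phi> \<epsilon> x)) K)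
                    (\<lambda>x. ennreal (rescale \<phi> \<epsilon> x))"

(* Gamma-convergence on the space X with distance dst of a family indexed by
   \<epsilon> > 0, as \<epsilon> tends to 0. *)
definition gamma_converges ::
  "'m set \<Rightarrow> ('m \<Rightarrow> 'm \<Rightarrow> real) \<Rightarrow> (real \<Rightarrow> 'm \<Rightarrow> ennreal) \<Rightarrow> ('m \<Rightarrow> ennreal) \<Rightarrow> bool" where
  "gamma_converges X dst F F0 \<longleftrightarrow>
     (\<forall>u x. (\<forall>\<epsilon>>0. u \<epsilon> \<in> X) \<longrightarrow> x \<in> X \<longrightarrow> ((\<lambda>\<epsilon>. dst (u \<epsilon>) x) \<longlongrightarrow> 0) (at_right 0) \<longrightarrow>
        Liminf (at_right 0) (\<lambda>\<epsilon>. F \<epsilon> (u \<epsilon>)) \<ge> F0 x) \<and>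
     (\<forall>x\<in>X. \<exists>u. (\<forall>\<epsilon>>0. u \<epsilon> \<in> X) \<and> ((\<lambda>\<epsilon>. dst (u \<epsilon>) x) \<longlongrightarrow> 0) (at_right 0) \<and>
        ((\<lambda>\<epsilon>. F \<epsilon> (u \<epsilon>)) \<longlongrightarrow> F0 x) (at_right 0))"

end

theory Submission
  imports Defs
begin

text \<open>
  Write \<open>d\<close> for the dimension and \<open>\<psi>\<^sub>\<epsilon>\<close> for the convolution of the rescaled mollifier with itself.
  Then the mollified kernel is \<open>K\<^sub>\<epsilon>(x) = \<integral> K(x - w) \<psi>\<^sub>\<epsilon>(w) dw\<close> (\<open>mollified_kernel_eq\<close>), and only
  three properties of the probability density \<open>\<psi>\<^sub>\<epsilon>\<close> enter the proof: its mass is 1, its \<open>q\<close>-th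
  moment is \<open>O(\<epsilon>\<^sup>q)\<close>, and \<open>\<psi>\<^sub>\<epsilon>(w) \<le> A |w|\<^sup>-\<^sup>d\<close> with a constant \<open>A\<close> that does not depend on \<open>\<epsilon>\<close>,
  because this bound is invariant under the rescaling.

  Lower semicontinuity. The truncation \<open>min n K\<close> is bounded and uniformly continuous, so
  replacing its argument \<open>x' - y'\<close> by \<open>x - y - w\<close> costs at most \<open>\<eta> + B (|x - x'|\<^sup>2 + |y - y'|\<^sup>2 + |w|\<^sup>q)\<close>.
  Integrating this against a nearly optimal coupling in \<open>(x, x')\<close>, the same coupling in
  \<open>(y, y')\<close>, and \<open>\<psi>\<^sub>\<epsilon>\<close> in \<open>w\<close> bounds the truncated energy of \<open>\<mu>\<close> by \<open>E\<^sub>\<epsilon>(\<mu>\<^sub>\<epsilon>)\<close> up to quantities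
  that vanish with the Wasserstein distance and with \<open>\<epsilon>\<close> (\<open>energy_mollified_lower_bound\<close>).
  Monotone convergence in \<open>n\<close> removes the truncation (\<open>energy_liminf\<close>).

  Recovery sequence. The constant sequence \<open>\<nu>\<^sub>\<epsilon> = \<mu>\<close> works. One inequality is lower semicontinuity.
  For the other one, the kernel satisfies, for every small \<open>\<delta> > 0\<close>,
  \<open>K\<^sub>\<epsilon>(x) \<le> c(\<delta>) K(x) + D(\<delta>) (M\<^sub>\<epsilon> + |x|\<^sup>p min(1, M\<^sub>\<epsilon> |x|\<^sup>-\<^sup>q))\<close>,
  where \<open>M\<^sub>\<epsilon>\<close> is the \<open>q\<close>-th moment of \<open>\<psi>\<^sub>\<epsilon>\<close> and \<open>c(\<delta>) \<rightarrow> 1\<close> as \<open>\<delta> \<rightarrow> 0\<close>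
  (\<open>nn_integral_mollified_interaction_kernel_le\<close>). The point is the singularity of \<open>|x - w|\<^sup>p\<close> at
  \<open>w = x\<close>: on the ball of radius \<open>\<delta>|x|\<close> around \<open>x\<close> the density is at most a multiple of \<open>|x|\<^sup>-\<^sup>d\<close>, so
  by \<open>p > -d\<close> this ball contributes only a multiple of \<open>\<delta>\<^sup>p\<^sup>+\<^sup>d |x|\<^sup>p\<close>. If the energy of \<open>\<mu>\<close> is finite,
  then \<open>|x|\<^sup>p\<close> is integrable and dominated convergence makes the error term vanish as \<open>\<epsilon> \<rightarrow> 0\<close>;
  letting \<open>\<delta> \<rightarrow> 0\<close> afterwards gives the claim (\<open>energy_limsup\<close>).
\<close>

section \<open>Integrals of powers of the norm\<close>

lemma nn_integral_lborel_affine: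
  fixes f :: "'a::euclidean_space \<Rightarrow> ennreal"
  assumes [measurable]: "f \<in> borel_measurable borel" and "c \<noteq> 0"
  shows "(\<integral>\<^sup>+x. f x \<partial>lborel) = ennreal (\<bar>c\<bar> ^ DIM('a)) * (\<integral>\<^sup>+x. f (t + c *\<^sub>R x) \<partial>lborel)"
  by (subst lborel_affine[OF \<open>c \<noteq> 0\<close>, of t])
     (simp add: nn_integral_density nn_integral_distr nn_integral_cmult)

lemma nn_integral_lborel_diff:
  fixes f :: "'a::euclidean_space \<Rightarrow> ennreal"
  assumes "f \<in> borel_measurable borel"
  shows "(\<integral>\<^sup>+x. f (t - x) \<partial>lborel) = (\<integral>\<^sup>+x. f x \<partial>lborel)"
  using nn_integral_lborel_affine[OF assms, of "-1" t] by simp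

lemma nn_integral_norm_powr_scaling:
  fixes S :: "'a::euclidean_space set" and r a :: real
  assumes "r > 0" and [measurable]: "S \<in> sets borel"
  shows "(\<integral>\<^sup>+v. indicator S (v /\<^sub>R r) * ennreal (norm v powr a) \<partial>lborel) =
    ennreal (r powr (a + DIM('a))) * (\<integral>\<^sup>+v. indicator S v * ennreal (norm v powr a) \<partial>lborel)"
proof -
  have "(\<integral>\<^sup>+v. indicator S (v /\<^sub>R r) * ennreal (norm v powr a) \<partial>lborel) =
    ennreal (\<bar>r\<bar> ^ DIM('a)) * (\<integral>\<^sup>+v. indicator S ((0 + r *\<^sub>R v) /\<^sub>R r) *
       ennreal (norm (0 + r *\<^sub>R v) powr a) \<partial>lborel)"
    using assms by (intro nn_integral_lborel_affine) auto
  also have "\<dots> = ennreal (r ^ DIM('a)) * (\<integral>\<^sup>+v. ennreal (r powr a) *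
      (indicator S v * ennreal (norm v powr a)) \<partial>lborel)"
    using assms by (auto intro!: arg_cong2[where f="(*)"] nn_integral_cong
        simp: powr_mult ennreal_mult ac_simps)
  also have "\<dots> = ennreal (r powr (a + DIM('a))) *
      (\<integral>\<^sup>+v. indicator S v * ennreal (norm v powr a) \<partial>lborel)"
    using assms by (subst nn_integral_cmult) (simp_all add: powr_add powr_realpow ennreal_mult ac_simps)
  finally show ?thesis .
qed

lemma nn_integral_norm_powr_unit_annulus_finite:
  "(\<integral>\<^sup>+v. indicator {v. 1 \<le> norm v \<and> norm v < 2} v * ennreal (norm (v::'a::euclidean_space) powr a) \<partial>lborel) < \<infinity>"
proof -
  have "(\<integral>\<^sup>+v. indicator {v. 1 \<le> norm v \<and> norm v < 2} v * ennreal (norm (v::'a) powr a) \<partial>lborel)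
     \<le> (\<integral>\<^sup>+v. ennreal (2 powr \<bar>a\<bar>) * indicator (ball (0::'a) 2) v \<partial>lborel)"
  proof (rule nn_integral_mono)
    fix v :: 'a
    have "norm v powr a \<le> 2 powr \<bar>a\<bar>" if "1 \<le> norm v" "norm v < 2"
    proof -
      have "norm v powr a \<le> norm v powr \<bar>a\<bar>" using that by (intro powr_mono) auto
      also have "\<dots> \<le> 2 powr \<bar>a\<bar>" using that by (intro powr_mono2) auto
      finally show ?thesis .
    qed
    then show "indicator {v. 1 \<le> norm v \<and> norm v < 2} v * ennreal (norm v powr a)
        \<le> ennreal (2 powr \<bar>a\<bar>) * indicator (ball 0 2) v"
      by (auto simp: indicator_def intro!: ennreal_leI)
  qed
  also have "\<dots> < \<infinity>"
    using emeasure_lborel_ball_finite[of "0::'a" 2]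
    by (subst nn_integral_cmult_indicator) (simp_all add: ennreal_mult_less_top)
  finally show ?thesis .
qed

text \<open>
  By scaling, the dyadic annulus of inner radius \<open>r n\<close> contributes \<open>r n powr (a + DIM('a))\<close> times the
  integral over the unit annulus. Covering by annuli thus reduces finiteness to a numerical series, for
  the singularity at the origin and for the tail at infinity alike.
\<close>

lemma nn_integral_norm_powr_dyadic_finite:
  fixes S :: "'a::euclidean_space set" and r :: "nat \<Rightarrow> real" and a :: real
  assumes sum: "summable (\<lambda>n. r n powr (a + DIM('a)))" and pos: "\<And>n. r n > 0"
    and cover: "\<And>v. v \<in> S \<Longrightarrow> v \<noteq> 0 \<Longrightarrow> \<exists>n. r n \<le> norm v \<and> norm v < 2 * r n"
  shows "(\<integral>\<^sup>+v. indicator S v * ennreal (norm v powr a) \<partial>lborel) < \<infinity>"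
proof -
  define J where "J = (\<integral>\<^sup>+v. indicator {v. 1 \<le> norm v \<and> norm v < 2} v * ennreal (norm (v::'a) powr a) \<partial>lborel)"
  define A where "A n v = (indicator {v. 1 \<le> norm v \<and> norm v < 2} (v /\<^sub>R r n) * ennreal (norm v powr a))"
    for n and v :: 'a
  have [measurable]: "A n \<in> borel_measurable borel" for n unfolding A_def by measurable
  have "(\<integral>\<^sup>+v. indicator S v * ennreal (norm v powr a) \<partial>lborel) \<le> (\<integral>\<^sup>+v. (\<Sum>n. A n v) \<partial>lborel)"
  proof (rule nn_integral_mono)
    fix v :: 'a
    show "indicator S v * ennreal (norm v powr a) \<le> (\<Sum>n. A n v)"
    proof (cases "v \<in> S \<and> v \<noteq> 0")
      case True
      then obtain n where "r n \<le> norm v \<and> norm v < 2 * r n" using cover by blast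
      then have "indicator S v * ennreal (norm v powr a) = (\<Sum>k\<in>{n}. A k v)"
        using True pos[of n] by (simp add: A_def field_simps)
      also have "\<dots> \<le> (\<Sum>n. A n v)" by (rule sum_le_suminf) auto
      finally show ?thesis .
    qed auto
  qed
  also have "\<dots> = (\<Sum>n. ennreal (r n powr (a + DIM('a))) * J)"
    using nn_integral_norm_powr_scaling[OF pos, of "{v::'a. 1 \<le> norm v \<and> norm v < 2}" _ a]
    by (subst nn_integral_suminf) (simp_all add: A_def[abs_def] J_def)
  also have "\<dots> = ennreal (\<Sum>n. r n powr (a + DIM('a))) * J"
    using sum by (simp add: ennreal_suminf_multc suminf_ennreal2)
  also have "\<dots> < \<infinity>"
    using nn_integral_norm_powr_unit_annulus_finite[where 'a='a, of a]
    by (simp add: J_def ennreal_mult_less_top)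
  finally show ?thesis .
qed

lemma dyadic_position:
  fixes t :: real
  assumes "t > 0"
  shows "2 powr of_int \<lfloor>log 2 t\<rfloor> \<le> t" "t < 2 * 2 powr of_int \<lfloor>log 2 t\<rfloor>"
proof -
  have "2 powr of_int \<lfloor>log 2 t\<rfloor> \<le> 2 powr log 2 t" by (intro powr_mono) auto
  then show "2 powr of_int \<lfloor>log 2 t\<rfloor> \<le> t" using assms by simp
  have "t = 2 powr log 2 t" using assms by simp
  also have "\<dots> < 2 powr (1 + of_int \<lfloor>log 2 t\<rfloor>)" by (intro powr_less_mono) linarith+
  finally show "t < 2 * 2 powr of_int \<lfloor>log 2 t\<rfloor>" by (simp add: powr_add)
qed

lemma nn_integral_norm_powr_ball_finite:
  assumes "a > - real DIM('a::euclidean_space)"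
  shows "(\<integral>\<^sup>+v. indicator (ball 0 1) v * ennreal (norm (v::'a) powr a) \<partial>lborel) < \<infinity>"
proof (rule nn_integral_norm_powr_dyadic_finite[where r="\<lambda>n. 2 powr (- real n - 1)"])
  have eq: "(2 powr (- real n - 1)) powr (a + real DIM('a)) =
      2 powr (- (a + DIM('a))) * (2 powr (- (a + DIM('a)))) ^ n" for n
  proof -
    have "(2 powr (- (a + DIM('a)))) ^ n = 2 powr (- (a + DIM('a)) * n)"
      by (simp add: powr_powr powr_realpow[symmetric])
    moreover have "(- real n - 1) * (a + DIM('a)) = - (a + DIM('a)) + - (a + DIM('a)) * n"
      by (simp add: algebra_simps)
    ultimately show ?thesis by (simp only: powr_powr powr_add[symmetric])
  qed
  show "summable (\<lambda>n. (2 powr (- real n - 1)) powr (a + real DIM('a)))"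
    unfolding eq using assms powr_less_mono[of "- (a + DIM('a))" 0 2]
    by (intro summable_mult summable_geometric) auto
  fix v :: 'a assume v: "v \<in> ball 0 1" "v \<noteq> 0"
  define k where "k = \<lfloor>log 2 (norm v)\<rfloor>"
  have "k < 0" using v by (simp add: k_def floor_less_iff)
  then have "- real (nat (- k - 1)) - 1 = of_int k" by simp
  then show "\<exists>n. 2 powr (- real n - 1) \<le> norm v \<and> norm v < 2 * 2 powr (- real n - 1)"
    using dyadic_position[of "norm v"] v unfolding k_def by (intro exI[of _ "nat (- k - 1)"]) (simp add: k_def)
qed simp

lemma nn_integral_norm_powr_tail_finite:
  assumes "a < - real DIM('a::euclidean_space)"
  shows "(\<integral>\<^sup>+v. indicator (- ball 0 1) v * ennreal (norm (v::'a) powr a) \<partial>lborel) < \<infinity>"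
proof (rule nn_integral_norm_powr_dyadic_finite[where r="\<lambda>n. 2 powr (real n)"])
  have eq: "(2 powr (real n)) powr (a + real DIM('a)) = (2 powr (a + DIM('a))) ^ n" for n
    by (simp add: powr_powr powr_realpow[symmetric] algebra_simps)
  show "summable (\<lambda>n. (2 powr (real n)) powr (a + real DIM('a)))"
    unfolding eq using assms powr_less_mono[of "a + DIM('a)" 0 2]
    by (intro summable_geometric) auto
  fix v :: 'a assume v: "v \<in> - ball 0 1" "v \<noteq> 0"
  define k where "k = \<lfloor>log 2 (norm v)\<rfloor>"
  have "k \<ge> 0" using v by (simp add: k_def le_floor_iff)
  then have "real (nat k) = of_int k" by simp
  then show "\<exists>n. 2 powr (real n) \<le> norm v \<and> norm v < 2 * 2 powr (real n)"
    using dyadic_position[of "norm v"] v unfolding k_def by (intro exI[of _ "nat k"]) (simp add: k_def)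
qed simp

lemma nn_integral_norm_powr_ball_scaling:
  assumes "r > 0"
  shows "(\<integral>\<^sup>+v. indicator (ball 0 r) v * ennreal (norm (v::'a::euclidean_space) powr a) \<partial>lborel) =
    ennreal (r powr (a + DIM('a))) * (\<integral>\<^sup>+v. indicator (ball 0 1) v * ennreal (norm (v::'a) powr a) \<partial>lborel)"
proof -
  have "indicator (ball 0 r) v = (indicator (ball 0 1) (v /\<^sub>R r) :: ennreal)" for v :: 'a
    using assms by (simp add: indicator_def divide_inverse_commute[symmetric])
  then show ?thesis using nn_integral_norm_powr_scaling[OF assms, of "ball 0 1"] by simp
qed

section \<open>The mollified kernel as a single convolution\<close>

text \<open>
  For \<open>s = DIM('a)\<close> the right-hand side is invariant under the rescaling of a mollifier, so the constant
  \<open>A\<close> serves all \<open>\<epsilon>\<close> at once. Decay gives the bound outside the unit ball; inside it,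
  boundedness of \<open>\<phi>\<close> suffices, since there \<open>norm x powr (- s) \<ge> 1\<close>.
\<close>

lemma continuous_decay_imp_scale_invariant_bound:
  fixes \<phi> :: "'a::euclidean_space \<Rightarrow> real"
  assumes cont: "continuous_on UNIV \<phi>" and "s \<ge> 0" "l \<ge> s"
    and decay: "\<And>x. x \<noteq> 0 \<Longrightarrow> \<phi> x \<le> C * norm x powr (- l)"
  shows "\<exists>A\<ge>0. \<forall>x. x \<noteq> 0 \<longrightarrow> \<phi> x \<le> A * norm x powr (- s)"
proof -
  have "bounded (\<phi> ` cball 0 1)"
    by (intro compact_imp_bounded compact_continuous_image continuous_on_subset[OF cont]) auto
  then obtain B where "\<forall>x\<in>cball 0 1. \<bar>\<phi> x\<bar> \<le> B"
    unfolding bounded_iff by auto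
  then have B: "\<bar>\<phi> x\<bar> \<le> B" if "norm x \<le> 1" for x
    using that by simp
  have "B \<ge> 0" using B[of 0] by simp
  have "\<phi> x \<le> max B \<bar>C\<bar> * norm x powr (- s)" if "x \<noteq> 0" for x
  proof (cases "norm x \<le> 1")
    case True
    then have "1 \<le> norm x powr (- s)"
      using powr_mono'[of "- s" 0 "norm x"] assms(2) that by simp
    then have "B * 1 \<le> max B \<bar>C\<bar> * norm x powr (- s)"
      using \<open>B \<ge> 0\<close> by (intro mult_mono) auto
    then show ?thesis using B[OF True] by simp
  next
    case False
    have "\<phi> x \<le> C * norm x powr (- l)" using decay that by blast
    also have "\<dots> \<le> max B \<bar>C\<bar> * norm x powr (- s)"
      using False assms(3) by (intro mult_mono powr_mono) auto
    finally show ?thesis .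
  qed
  then show ?thesis using \<open>B \<ge> 0\<close> by (intro exI[of _ "max B \<bar>C\<bar>"]) auto
qed

lemma rescale_le:
  fixes \<phi> :: "'a::euclidean_space \<Rightarrow> real"
  assumes "\<And>x. x \<noteq> 0 \<Longrightarrow> \<phi> x \<le> A * norm x powr (- real DIM('a))" "\<epsilon> > 0" "x \<noteq> 0"
  shows "rescale \<phi> \<epsilon> x \<le> A * norm x powr (- real DIM('a))"
proof -
  have "rescale \<phi> \<epsilon> x \<le> (A * norm (x /\<^sub>R \<epsilon>) powr (- real DIM('a))) / \<epsilon> ^ DIM('a)"
    unfolding rescale_def using assms(2,3) by (intro divide_right_mono assms(1)) auto
  also have "norm (x /\<^sub>R \<epsilon>) powr (- real DIM('a)) = norm x powr (- real DIM('a)) * \<epsilon> ^ DIM('a)"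
    using assms by (simp add: powr_mult powr_minus powr_realpow[symmetric] inverse_powr)
  finally show ?thesis using assms by simp
qed

lemma nn_integral_rescale:
  fixes \<phi> :: "'a::euclidean_space \<Rightarrow> real"
  assumes [measurable]: "\<phi> \<in> borel_measurable borel" "f \<in> borel_measurable borel"
    and "\<epsilon> > 0" and "\<And>x. 0 \<le> \<phi> x"
  shows "(\<integral>\<^sup>+x. f x * ennreal (rescale \<phi> \<epsilon> x) \<partial>lborel) = (\<integral>\<^sup>+x. f (\<epsilon> *\<^sub>R x) * ennreal (\<phi> x) \<partial>lborel)"
proof -
  have [measurable]: "rescale \<phi> \<epsilon> \<in> borel_measurable borel"
    unfolding rescale_def[abs_def] by measurable
  have "(\<integral>\<^sup>+x. f x * ennreal (rescale \<phi> \<epsilon> x) \<partial>lborel) =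
      ennreal (\<epsilon> ^ DIM('a)) * (\<integral>\<^sup>+x. f (\<epsilon> *\<^sub>R x) * ennreal (rescale \<phi> \<epsilon> (\<epsilon> *\<^sub>R x)) \<partial>lborel)"
    using nn_integral_lborel_affine[of "\<lambda>x. f x * ennreal (rescale \<phi> \<epsilon> x)" \<epsilon> 0] assms(3) by simp
  also have "\<dots> = (\<integral>\<^sup>+x. ennreal (\<epsilon> ^ DIM('a)) * (f (\<epsilon> *\<^sub>R x) * ennreal (rescale \<phi> \<epsilon> (\<epsilon> *\<^sub>R x))) \<partial>lborel)"
    by (subst nn_integral_cmult) simp_all
  also have "\<dots> = (\<integral>\<^sup>+x. f (\<epsilon> *\<^sub>R x) * ennreal (\<phi> x) \<partial>lborel)"
  proof (rule nn_integral_cong)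
    fix x :: 'a
    have "ennreal (\<phi> x) = ennreal (\<epsilon> ^ DIM('a)) * ennreal (rescale \<phi> \<epsilon> (\<epsilon> *\<^sub>R x))"
      using assms(3,4) by (simp add: rescale_def ennreal_mult[symmetric])
    then show "ennreal (\<epsilon> ^ DIM('a)) * (f (\<epsilon> *\<^sub>R x) * ennreal (rescale \<phi> \<epsilon> (\<epsilon> *\<^sub>R x))) =
        f (\<epsilon> *\<^sub>R x) * ennreal (\<phi> x)" by (simp add: ac_simps)
  qed
  finally show ?thesis .
qed

text \<open>
  A convolution is the law of a sum of independent variables, here with \<open>\<sigma>\<close>-finite laws. The kernel
  formula, the mass and the moment estimate below are all instances.
\<close>

lemma nn_integral_nn_convolution:
  fixes f g F :: "'a::euclidean_space \<Rightarrow> ennreal"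
  assumes [measurable]: "f \<in> borel_measurable borel" "g \<in> borel_measurable borel" "F \<in> borel_measurable borel"
  shows "(\<integral>\<^sup>+w. F w * nn_convolution f g w \<partial>lborel) = (\<integral>\<^sup>+y. (\<integral>\<^sup>+z. F (y + z) * f z \<partial>lborel) * g y \<partial>lborel)"
proof -
  have "(\<integral>\<^sup>+w. F w * nn_convolution f g w \<partial>lborel) = (\<integral>\<^sup>+w. \<integral>\<^sup>+y. F w * (f (w - y) * g y) \<partial>lborel \<partial>lborel)"
    unfolding nn_convolution_def by (subst nn_integral_cmult) simp_all
  also have "\<dots> = (\<integral>\<^sup>+y. \<integral>\<^sup>+w. F w * (f (w - y) * g y) \<partial>lborel \<partial>lborel)"
    by (rule lborel_pair.Fubini') measurable
  also have "\<dots> = (\<integral>\<^sup>+y. (\<integral>\<^sup>+w. F w * f (w - y) \<partial>lborel) * g y \<partial>lborel)"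
    by (intro nn_integral_cong) (subst nn_integral_multc[symmetric], simp_all add: ac_simps)
  also have "\<dots> = (\<integral>\<^sup>+y. (\<integral>\<^sup>+z. F (y + z) * f z \<partial>lborel) * g y \<partial>lborel)"
  proof -
    have "(\<integral>\<^sup>+w. F w * f (w - y) \<partial>lborel) = (\<integral>\<^sup>+z. F (y + z) * f z \<partial>lborel)" for y
      using nn_integral_lborel_affine[of "\<lambda>w. F w * f (w - y)" 1 y] by simp
    then show ?thesis by simp
  qed
  finally show ?thesis .
qed

lemma borel_measurable_nn_convolution [measurable]:
  fixes f g :: "'a::euclidean_space \<Rightarrow> ennreal"
  assumes [measurable]: "f \<in> borel_measurable borel" "g \<in> borel_measurable borel"
  shows "nn_convolution f g \<in> borel_measurable borel"
  unfolding nn_convolution_def[abs_def] by measurable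

text \<open>
  Mollifying \<open>K\<close> from both sides is one convolution with the density of the sum of two independent
  copies of the mollifier. With a single integration variable left,
  estimates on \<open>K\<^sub>\<epsilon>\<close> become estimates against one probability density.
\<close>

lemma mollified_kernel_eq:
  fixes \<phi> :: "'a::euclidean_space \<Rightarrow> real" and \<epsilon> :: real
  assumes [measurable]: "\<phi> \<in> borel_measurable borel" "K \<in> borel_measurable borel"
  defines "g \<equiv> \<lambda>x. ennreal (rescale \<phi> \<epsilon> x)"
  shows "mollified_kernel \<phi> K \<epsilon> x = (\<integral>\<^sup>+w. K (x - w) * nn_convolution g g w \<partial>lborel)"
proof -
  have [measurable]: "g \<in> borel_measurable borel"
    unfolding g_def rescale_def[abs_def] by measurable
  have "(\<integral>\<^sup>+z. g (x - y - z) * K z \<partial>lborel) = (\<integral>\<^sup>+z. K (x - (y + z)) * g z \<partial>lborel)" for y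
    using nn_integral_lborel_diff[of "\<lambda>z. g (x - y - z) * K z" "x - y"]
    by (simp add: algebra_simps)
  then show ?thesis
    unfolding mollified_kernel_def g_def[symmetric]
    by (subst nn_integral_nn_convolution) (simp_all add: nn_convolution_def)
qed

lemma nn_integral_nn_convolution_self:
  fixes g :: "'a::euclidean_space \<Rightarrow> ennreal"
  assumes [measurable]: "g \<in> borel_measurable borel" and "(\<integral>\<^sup>+x. g x \<partial>lborel) = 1"
  shows "(\<integral>\<^sup>+w. nn_convolution g g w \<partial>lborel) = 1"
  using nn_integral_nn_convolution[of g g "\<lambda>_. 1"] assms(2) by simp

text \<open>
  Since \<open>x = y + (x - y)\<close>, one of the two arguments has norm at least \<open>norm x / 2\<close>; bounding \<open>g\<close> there
  leaves a factor that integrates to 1.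
\<close>

lemma nn_convolution_self_le:
  fixes g :: "'a::euclidean_space \<Rightarrow> ennreal"
  assumes [measurable]: "g \<in> borel_measurable borel" and mass: "(\<integral>\<^sup>+x. g x \<partial>lborel) = 1"
    and le: "\<And>x. x \<noteq> 0 \<Longrightarrow> g x \<le> ennreal (A * norm x powr (- s))"
    and "s \<ge> 0" "A \<ge> 0" "x \<noteq> 0"
  shows "nn_convolution g g x \<le> ennreal (2 * 2 powr s * A * norm x powr (- s))"
proof -
  define E where "E = ennreal (2 powr s * A * norm x powr (- s))"
  have far: "g y \<le> E" if "norm x / 2 \<le> norm y" for y
  proof -
    have "y \<noteq> 0" using that \<open>x \<noteq> 0\<close> by auto
    then have "g y \<le> ennreal (A * norm y powr (- s))" by (rule le)
    also have "\<dots> \<le> ennreal (A * (norm x / 2) powr (- s))"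
      using that assms by (intro ennreal_leI mult_left_mono powr_mono2') auto
    also have "(norm x / 2) powr (- s) = 2 powr s * norm x powr (- s)"
      by (simp add: powr_divide powr_minus field_simps)
    finally show ?thesis by (simp add: E_def ac_simps)
  qed
  have "g (x - y) * g y \<le> E * g y + E * g (x - y)" for y
  proof -
    have "norm x \<le> norm y + norm (x - y)" by (metis add.commute diff_add_cancel norm_triangle_ineq)
    then consider "norm x / 2 \<le> norm y" | "norm x / 2 \<le> norm (x - y)" by linarith
    then show ?thesis
    proof cases
      case 1
      have "g (x - y) * g y \<le> E * g (x - y)"
        using far[OF 1] by (subst mult.commute) (intro mult_right_mono, auto)
      then show ?thesis using add_increasing[of "E * g y"] by auto
    next
      case 2
      have "g (x - y) * g y \<le> E * g y"
        using far[OF 2] by (intro mult_right_mono) auto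
      then show ?thesis using add_increasing2[of "E * g (x - y)"] by auto
    qed
  qed
  then have "nn_convolution g g x \<le> (\<integral>\<^sup>+y. E * g y + E * g (x - y) \<partial>lborel)"
    unfolding nn_convolution_def by (intro nn_integral_mono)
  also have "\<dots> = E * (\<integral>\<^sup>+y. g y \<partial>lborel) + E * (\<integral>\<^sup>+y. g (x - y) \<partial>lborel)"
    by (subst nn_integral_add) (simp_all add: nn_integral_cmult)
  also have "\<dots> = E + E" by (simp add: nn_integral_lborel_diff mass)
  also have "\<dots> = ennreal (2 * 2 powr s * A * norm x powr (- s))"
    using assms by (simp add: E_def ennreal_plus[symmetric] del: ennreal_plus)
  finally show ?thesis .
qed

lemma moment_nn_convolution_self_le:
  fixes g :: "'a::euclidean_space \<Rightarrow> ennreal"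
  assumes [measurable]: "g \<in> borel_measurable borel" and mass: "(\<integral>\<^sup>+x. g x \<partial>lborel) = 1" and "q \<ge> 0"
  shows "(\<integral>\<^sup>+w. ennreal (norm w powr q) * nn_convolution g g w \<partial>lborel)
    \<le> ennreal (2 * 2 powr q) * (\<integral>\<^sup>+z. ennreal (norm z powr q) * g z \<partial>lborel)"
proof -
  define m where "m = (\<integral>\<^sup>+z. ennreal (norm z powr q) * g z \<partial>lborel)"
  have sum: "ennreal (norm (y + z) powr q) \<le> ennreal (2 powr q) * (ennreal (norm y powr q) + ennreal (norm z powr q))" for y z :: 'a
  proof -
    have "norm (y + z) powr q \<le> (2 * max (norm y) (norm z)) powr q"
      using norm_triangle_ineq[of y z] \<open>q \<ge> 0\<close> by (intro powr_mono2) auto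
    also have "\<dots> \<le> 2 powr q * (norm y powr q + norm z powr q)"
      by (auto simp: powr_mult max_def)
    finally show ?thesis
      by (simp add: ennreal_mult[symmetric] ennreal_plus[symmetric] ennreal_leI del: ennreal_plus)
  qed
  have "(\<integral>\<^sup>+w. ennreal (norm w powr q) * nn_convolution g g w \<partial>lborel) =
     (\<integral>\<^sup>+y. (\<integral>\<^sup>+z. ennreal (norm (y + z) powr q) * g z \<partial>lborel) * g y \<partial>lborel)"
    by (rule nn_integral_nn_convolution) measurable
  also have "\<dots> \<le> (\<integral>\<^sup>+y. ennreal (2 powr q) * (ennreal (norm y powr q) + m) * g y \<partial>lborel)"
  proof (intro nn_integral_mono mult_right_mono)
    fix y :: 'a
    have "(\<integral>\<^sup>+z. ennreal (norm (y + z) powr q) * g z \<partial>lborel)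
        \<le> (\<integral>\<^sup>+z. ennreal (2 powr q) * (ennreal (norm y powr q) * g z + ennreal (norm z powr q) * g z) \<partial>lborel)"
      using sum by (intro nn_integral_mono) (simp add: distrib_right[symmetric] mult.assoc[symmetric] mult_right_mono)
    also have "\<dots> = ennreal (2 powr q) * (ennreal (norm y powr q) + m)"
      by (simp add: nn_integral_cmult nn_integral_add mass m_def)
    finally show "(\<integral>\<^sup>+z. ennreal (norm (y + z) powr q) * g z \<partial>lborel)
        \<le> ennreal (2 powr q) * (ennreal (norm y powr q) + m)" .
  qed simp
  also have "\<dots> = (\<integral>\<^sup>+y. ennreal (2 powr q) * (ennreal (norm y powr q) * g y + m * g y) \<partial>lborel)"
    by (simp add: distrib_right mult.assoc)
  also have "\<dots> = ennreal (2 powr q) * (m + m)"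
    by (simp add: nn_integral_cmult nn_integral_add mass m_def)
  also have "\<dots> = ennreal (2 * 2 powr q) * m"
    by (simp add: mult_2[symmetric] ennreal_mult ac_simps)
  finally show ?thesis unfolding m_def .
qed

lemma moment_finite:
  fixes \<phi> :: "'a::euclidean_space \<Rightarrow> real" and q l :: real
  assumes [measurable]: "\<phi> \<in> borel_measurable borel" and nonneg: "\<And>x. 0 \<le> \<phi> x"
    and mass: "(\<integral>\<^sup>+x. ennreal (\<phi> x) \<partial>lborel) < \<infinity>" and "q \<ge> 0" "l > q + DIM('a)"
    and decay: "\<And>x. x \<noteq> 0 \<Longrightarrow> \<phi> x \<le> C * norm x powr (- l)"
  shows "(\<integral>\<^sup>+z. ennreal (norm z powr q) * ennreal (\<phi> z) \<partial>lborel) < \<infinity>"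
proof -
  have "(\<integral>\<^sup>+z. ennreal (norm z powr q) * ennreal (\<phi> z) \<partial>lborel) \<le>
     (\<integral>\<^sup>+z. ennreal (\<phi> z) + ennreal \<bar>C\<bar> * (indicator (- ball 0 1) z * ennreal (norm z powr (q - l))) \<partial>lborel)"
  proof (rule nn_integral_mono)
    fix z :: 'a
    show "ennreal (norm z powr q) * ennreal (\<phi> z) \<le>
       ennreal (\<phi> z) + ennreal \<bar>C\<bar> * (indicator (- ball 0 1) z * ennreal (norm z powr (q - l)))"
    proof (cases "norm z < 1")
      case True
      then have "norm z powr q \<le> 1" using \<open>q \<ge> 0\<close> powr_mono2[of q "norm z" 1] by simp
      then have "norm z powr q * \<phi> z \<le> \<phi> z" using nonneg[of z] mult_right_mono by fastforce
      then show ?thesis using True nonneg[of z]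
        by (auto simp: ennreal_mult[symmetric] intro!: ennreal_leI)
    next
      case False
      then have "\<phi> z \<le> C * norm z powr (- l)" by (intro decay) auto
      also have "\<dots> \<le> \<bar>C\<bar> * norm z powr (- l)" by (intro mult_right_mono) auto
      finally have "norm z powr q * \<phi> z \<le> norm z powr q * (\<bar>C\<bar> * norm z powr (- l))"
        by (intro mult_left_mono) auto
      also have "\<dots> = \<bar>C\<bar> * norm z powr (q - l)" by (simp add: powr_diff powr_minus field_simps)
      finally have "ennreal (norm z powr q) * ennreal (\<phi> z) \<le> ennreal \<bar>C\<bar> * ennreal (norm z powr (q - l))"
        using nonneg[of z] by (simp add: ennreal_mult[symmetric] ennreal_leI)
      then show ?thesis using False by (simp add: add_increasing)
    qed
  qed
  also have "\<dots> = (\<integral>\<^sup>+z. ennreal (\<phi> z) \<partial>lborel) +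
      ennreal \<bar>C\<bar> * (\<integral>\<^sup>+z. indicator (- ball 0 1) z * ennreal (norm (z::'a) powr (q - l)) \<partial>lborel)"
    by (subst nn_integral_add) (simp_all add: nn_integral_cmult)
  also have "\<dots> < \<infinity>"
    using mass nn_integral_norm_powr_tail_finite[where 'a='a, of "q - l"] \<open>l > q + DIM('a)\<close>
    by (simp add: ennreal_mult_less_top)
  finally show ?thesis .
qed

section \<open>Upper bound for the mollified kernel\<close>

text \<open>
  The domain of \<open>w\<close> is split into three parts. Where \<open>w\<close> is within \<open>\<delta> |x|\<close> of \<open>x\<close>, the singularity is
  integrated against Lebesgue measure, as \<open>\<psi> w\<close> is bounded by a multiple of \<open>|x|\<^sup>-\<^sup>d\<close>; this yields the
  factor \<open>\<delta> powr (p + d)\<close>. Where \<open>|w| < \<delta> |x|\<close>, the integrand is close to \<open>|x|\<^sup>p\<close>. On the rest the integrand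
  is at most \<open>(\<delta> |x|)\<^sup>p\<close>, and the mass of \<open>\<psi>\<close> there is bounded both by 1 and, through Markov's
  inequality, by the \<open>q\<close>-th moment. The minimum of these two bounds is kept because the moment bound alone
  would produce \<open>|x| powr (p - q)\<close>, which need not be integrable when the energy is finite.
\<close>

lemma nn_integral_mollified_negative_power_le:
  fixes \<psi> :: "'a::euclidean_space \<Rightarrow> ennreal" and p q \<delta> A J :: real
  assumes [measurable]: "\<psi> \<in> borel_measurable borel" and mass: "(\<integral>\<^sup>+w. \<psi> w \<partial>lborel) = 1"
    and le: "\<And>w. w \<noteq> 0 \<Longrightarrow> \<psi> w \<le> ennreal (A * norm w powr (- real DIM('a)))"
    and "A \<ge> 0" "p < 0" "q > 0" and \<delta>: "0 < \<delta>" "\<delta> \<le> 1/2" and "x \<noteq> 0" and "J \<ge> 0"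
    and J: "(\<integral>\<^sup>+v. indicator (ball 0 1) v * ennreal (norm (v::'a) powr p) \<partial>lborel) = ennreal J"
  shows "(\<integral>\<^sup>+w. ennreal (norm (x - w) powr p) * \<psi> w \<partial>lborel) \<le>
     ennreal (((1 - \<delta>) powr p + A * 2 ^ DIM('a) * J * \<delta> powr (p + DIM('a))) * norm x powr p)
     + ennreal (\<delta> powr (p - q) * norm x powr p) *
        min 1 (ennreal (norm x powr (- q)) * (\<integral>\<^sup>+w. ennreal (norm w powr q) * \<psi> w \<partial>lborel))"
proof -
  define M where "M = (\<integral>\<^sup>+w. ennreal (norm w powr q) * \<psi> w \<partial>lborel)"
  define E where "E = A * (norm x / 2) powr (- real DIM('a))"
  define T where "T w = indicator {w. \<delta> * norm x \<le> norm w} w * \<psi> w" for w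
  have [measurable]: "T \<in> borel_measurable borel" unfolding T_def[abs_def] by measurable
  have [measurable]: "ball (0::'a) r \<in> sets borel" for r by simp
  have nx: "norm x > 0" using \<open>x \<noteq> 0\<close> by simp
  have pointwise: "ennreal (norm (x - w) powr p) * \<psi> w \<le>
      ennreal E * (indicator (ball 0 (\<delta> * norm x)) (x - w) * ennreal (norm (x - w) powr p))
      + (ennreal ((1 - \<delta>) powr p * norm x powr p) * \<psi> w
      + ennreal (\<delta> powr p * norm x powr p) * T w)" (is "_ \<le> ?a + (?b + ?c)") for w
  proof -
    have tri: "norm x \<le> norm w + norm (x - w)"
      by (metis add.commute diff_add_cancel norm_triangle_ineq)
    consider "norm (x - w) < \<delta> * norm x" | "norm (x - w) \<ge> \<delta> * norm x" "norm w < \<delta> * norm x"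
      | "norm (x - w) \<ge> \<delta> * norm x" "norm w \<ge> \<delta> * norm x" by linarith
    then show ?thesis
    proof cases
      case 1
      \<comment> \<open>Here \<open>\<delta> \<le> 1/2\<close> keeps \<open>w\<close> away from the origin, where the bound on \<open>\<psi>\<close> blows up.\<close>
      have "\<delta> * norm x \<le> 1/2 * norm x" using \<delta> by (intro mult_right_mono) auto
      then have w: "norm x / 2 \<le> norm w" using 1 tri by simp
      then have "w \<noteq> 0" using nx by auto
      then have "\<psi> w \<le> ennreal (A * norm w powr (- real DIM('a)))" by (rule le)
      also have "\<dots> \<le> ennreal E"
        unfolding E_def using w nx \<open>A \<ge> 0\<close> by (intro ennreal_leI mult_left_mono powr_mono2') auto
      finally have "ennreal (norm (x - w) powr p) * \<psi> w \<le> ennreal (norm (x - w) powr p) * ennreal E"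
        by (intro mult_left_mono) auto
      also have "\<dots> = ?a" using 1 by (simp add: ac_simps)
      finally show ?thesis by (rule order_trans) simp
    next
      case 2
      then have "(1 - \<delta>) * norm x \<le> norm (x - w)" using tri by (simp add: algebra_simps)
      then have "norm (x - w) powr p \<le> ((1 - \<delta>) * norm x) powr p"
        using \<delta> nx \<open>p < 0\<close> by (intro powr_mono2') auto
      then have "norm (x - w) powr p \<le> (1 - \<delta>) powr p * norm x powr p"
        using \<delta> by (simp add: powr_mult)
      then have "ennreal (norm (x - w) powr p) * \<psi> w \<le> ?b"
        by (intro mult_right_mono ennreal_leI) auto
      also have "?b \<le> ?a + (?b + ?c)" by (simp add: add_increasing)
      finally show ?thesis .
    next
      case 3
      then have "norm (x - w) powr p \<le> (\<delta> * norm x) powr p"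
        using \<delta> nx \<open>p < 0\<close> by (intro powr_mono2') auto
      then have "norm (x - w) powr p \<le> \<delta> powr p * norm x powr p"
        using \<delta> by (simp add: powr_mult)
      then have "ennreal (norm (x - w) powr p) * \<psi> w \<le> ennreal (\<delta> powr p * norm x powr p) * \<psi> w"
        by (intro mult_right_mono ennreal_leI) auto
      also have "\<dots> = ?c" using 3 by (simp add: T_def)
      also have "?c \<le> ?a + (?b + ?c)" by (simp add: add_increasing)
      finally show ?thesis .
    qed
  qed
  have near: "(\<integral>\<^sup>+w. indicator (ball 0 (\<delta> * norm x)) (x - w) * ennreal (norm (x - w) powr p) \<partial>lborel)
      = ennreal ((\<delta> * norm x) powr (p + DIM('a)) * J)"
  proof -
    have "(\<lambda>v::'a. indicator (ball 0 (\<delta> * norm x)) v * ennreal (norm v powr p)) \<in> borel_measurable borel"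
      by measurable
    then show ?thesis
      using nn_integral_lborel_diff[of "\<lambda>v. indicator (ball 0 (\<delta> * norm x)) v * ennreal (norm v powr p)" x]
        nn_integral_norm_powr_ball_scaling[where 'a='a, of "\<delta> * norm x" p] \<delta> nx \<open>J \<ge> 0\<close>
      by (simp add: J ennreal_mult)
  qed
  have far: "(\<integral>\<^sup>+w. T w \<partial>lborel) \<le> ennreal (\<delta> powr (- q)) * min 1 (ennreal (norm x powr (- q)) * M)"
  proof -
    have "1 \<le> \<delta> powr (- q)" using powr_mono'[of "- q" 0 \<delta>] \<delta> \<open>q > 0\<close> by simp
    then have d1: "1 \<le> ennreal (\<delta> powr (- q))" by simp
    have "(\<integral>\<^sup>+w. T w \<partial>lborel) \<le> (\<integral>\<^sup>+w. \<psi> w \<partial>lborel)"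
      by (intro nn_integral_mono) (simp add: T_def indicator_def)
    then have 1: "(\<integral>\<^sup>+w. T w \<partial>lborel) \<le> ennreal (\<delta> powr (- q)) * 1"
      using d1 unfolding mass mult_1_right by (rule order_trans)
    have "(\<integral>\<^sup>+w. T w \<partial>lborel) \<le> (\<integral>\<^sup>+w. ennreal (\<delta> powr (- q)) * (ennreal (norm x powr (- q)) * (ennreal (norm w powr q) * \<psi> w)) \<partial>lborel)"
    proof (rule nn_integral_mono)
      fix w :: 'a
      show "T w \<le> ennreal (\<delta> powr (- q)) * (ennreal (norm x powr (- q)) * (ennreal (norm w powr q) * \<psi> w))"
      proof (cases "\<delta> * norm x \<le> norm w")
        case True
        then have "(\<delta> * norm x) powr q \<le> norm w powr q" using \<delta> nx \<open>q > 0\<close> by (intro powr_mono2) auto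
        then have "1 \<le> \<delta> powr (- q) * (norm x powr (- q) * norm w powr q)"
          using \<delta> nx by (simp add: powr_mult powr_minus field_simps)
        then have "1 \<le> ennreal (\<delta> powr (- q) * (norm x powr (- q) * norm w powr q))" by simp
        from mult_right_mono[OF this, of "\<psi> w"] True show ?thesis
          by (simp add: T_def ennreal_mult ac_simps)
      qed (simp add: T_def)
    qed
    also have "\<dots> = ennreal (\<delta> powr (- q)) * (ennreal (norm x powr (- q)) * M)"
      by (simp add: nn_integral_cmult M_def)
    finally show ?thesis using 1 by (auto simp: min_def)
  qed
  have "(\<integral>\<^sup>+w. ennreal (norm (x - w) powr p) * \<psi> w \<partial>lborel) \<le>
      (\<integral>\<^sup>+w. ennreal E * (indicator (ball 0 (\<delta> * norm x)) (x - w) * ennreal (norm (x - w) powr p))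
      + (ennreal ((1 - \<delta>) powr p * norm x powr p) * \<psi> w
      + ennreal (\<delta> powr p * norm x powr p) * T w) \<partial>lborel)"
    by (intro nn_integral_mono pointwise)
  also have "\<dots> = ennreal E * ennreal ((\<delta> * norm x) powr (p + DIM('a)) * J)
      + (ennreal ((1 - \<delta>) powr p * norm x powr p)
      + ennreal (\<delta> powr p * norm x powr p) * (\<integral>\<^sup>+w. T w \<partial>lborel))"
    by (simp add: nn_integral_add nn_integral_cmult near mass)
  also have "\<dots> \<le> ennreal E * ennreal ((\<delta> * norm x) powr (p + DIM('a)) * J)
      + (ennreal ((1 - \<delta>) powr p * norm x powr p)
      + ennreal (\<delta> powr p * norm x powr p) * (ennreal (\<delta> powr (- q)) * min 1 (ennreal (norm x powr (- q)) * M)))"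
    by (intro add_left_mono mult_left_mono far) simp
  also have "\<dots> = ennreal (E * ((\<delta> * norm x) powr (p + DIM('a)) * J) + (1 - \<delta>) powr p * norm x powr p)
      + ennreal (\<delta> powr (p - q) * norm x powr p) * min 1 (ennreal (norm x powr (- q)) * M)"
  proof -
    have "E \<ge> 0" using \<open>A \<ge> 0\<close> by (simp add: E_def)
    have "\<delta> powr (p - q) * norm x powr p = (\<delta> powr p * norm x powr p) * \<delta> powr (- q)"
      by (simp add: powr_diff powr_minus divide_inverse)
    then have "ennreal (\<delta> powr (p - q) * norm x powr p) = ennreal (\<delta> powr p * norm x powr p) * ennreal (\<delta> powr (- q))"
      by (simp only:) (rule ennreal_mult, auto)
    then show ?thesis
      using \<open>E \<ge> 0\<close> \<open>J \<ge> 0\<close> by (subst ennreal_plus) (auto simp: ennreal_mult[of E] add.assoc mult.assoc)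
  qed
  also have "E * ((\<delta> * norm x) powr (p + DIM('a)) * J) = A * 2 ^ DIM('a) * J * \<delta> powr (p + DIM('a)) * norm x powr p"
  proof -
    have "(norm x / 2) powr (- real DIM('a)) = 2 powr real DIM('a) * norm x powr (- real DIM('a))"
      by (simp add: powr_divide powr_minus field_simps)
    also have "2 powr real DIM('a) = 2 ^ DIM('a)" by (simp add: powr_realpow)
    finally have 1: "(norm x / 2) powr (- real DIM('a)) = 2 ^ DIM('a) * norm x powr (- real DIM('a))" .
    have 2: "(\<delta> * norm x) powr (p + DIM('a)) = \<delta> powr (p + DIM('a)) * (norm x powr p * norm x powr real DIM('a))"
      using \<delta> nx by (simp only: powr_mult powr_add ac_simps)
    have 3: "norm x powr (- real DIM('a)) * norm x powr real DIM('a) = 1"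
      using nx by (simp only: powr_add[symmetric]) simp
    have "E * ((\<delta> * norm x) powr (p + DIM('a)) * J) = A * 2 ^ DIM('a) * J * \<delta> powr (p + DIM('a)) * norm x powr p
        * (norm x powr (- real DIM('a)) * norm x powr real DIM('a))"
      unfolding E_def 1 2 by (simp only: ac_simps)
    then show ?thesis unfolding 3 by simp
  qed
  finally show ?thesis unfolding M_def by (simp add: algebra_simps)
qed

text \<open>
  If \<open>|w| \<le> \<delta> |x|\<close>, then \<open>|x - w| \<le> (1 + \<delta>) |x|\<close>; otherwise \<open>|x|\<close> is controlled by \<open>|w| / \<delta>\<close> and the whole
  integrand is absorbed by the moment.
\<close>

lemma nn_integral_mollified_positive_power_le:
  fixes \<psi> :: "'a::euclidean_space \<Rightarrow> ennreal" and q \<delta> :: real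
  assumes [measurable]: "\<psi> \<in> borel_measurable borel" and mass: "(\<integral>\<^sup>+w. \<psi> w \<partial>lborel) = 1"
    and "q > 0" "\<delta> > 0"
  shows "(\<integral>\<^sup>+w. ennreal (norm (x - w) powr q) * \<psi> w \<partial>lborel) \<le>
     ennreal ((1 + \<delta>) powr q * norm x powr q)
     + ennreal ((1 + 1 / \<delta>) powr q) * (\<integral>\<^sup>+w. ennreal (norm w powr q) * \<psi> w \<partial>lborel)"
proof -
  have pointwise: "norm (x - w) powr q \<le> (1 + \<delta>) powr q * norm x powr q + (1 + 1 / \<delta>) powr q * norm w powr q" for w
  proof (cases "norm w \<le> \<delta> * norm x")
    case True
    have "norm (x - w) \<le> (1 + \<delta>) * norm x"
      using norm_triangle_ineq4[of x w] True by (simp add: algebra_simps)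
    then have "norm (x - w) powr q \<le> ((1 + \<delta>) * norm x) powr q" using assms by (intro powr_mono2) auto
    then show ?thesis using assms by (simp add: powr_mult add_increasing2)
  next
    case False
    then have "norm x \<le> 1 / \<delta> * norm w" using assms by (simp add: field_simps)
    then have "norm (x - w) \<le> (1 + 1 / \<delta>) * norm w"
      using norm_triangle_ineq4[of x w] by (simp add: algebra_simps)
    then have "norm (x - w) powr q \<le> ((1 + 1 / \<delta>) * norm w) powr q" using assms by (intro powr_mono2) auto
    then show ?thesis using assms by (simp add: powr_mult add_increasing)
  qed
  have "(\<integral>\<^sup>+w. ennreal (norm (x - w) powr q) * \<psi> w \<partial>lborel) \<le>
     (\<integral>\<^sup>+w. ennreal ((1 + \<delta>) powr q * norm x powr q) * \<psi> w
       + ennreal ((1 + 1 / \<delta>) powr q) * (ennreal (norm w powr q) * \<psi> w) \<partial>lborel)"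
  proof (rule nn_integral_mono)
    fix w :: 'a
    have "ennreal (norm (x - w) powr q) \<le> ennreal ((1 + \<delta>) powr q * norm x powr q)
       + ennreal ((1 + 1 / \<delta>) powr q) * ennreal (norm w powr q)"
      using ennreal_leI[OF pointwise[of w]] by (simp add: ennreal_mult)
    from mult_right_mono[OF this, of "\<psi> w"]
    show "ennreal (norm (x - w) powr q) * \<psi> w \<le> ennreal ((1 + \<delta>) powr q * norm x powr q) * \<psi> w
       + ennreal ((1 + 1 / \<delta>) powr q) * (ennreal (norm w powr q) * \<psi> w)"
      by (simp add: distrib_right mult.assoc)
  qed
  also have "\<dots> = ennreal ((1 + \<delta>) powr q * norm x powr q)
     + ennreal ((1 + 1 / \<delta>) powr q) * (\<integral>\<^sup>+w. ennreal (norm w powr q) * \<psi> w \<partial>lborel)"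
    by (simp add: nn_integral_add nn_integral_cmult mass)
  finally show ?thesis .
qed

lemma borel_measurable_interaction_kernel [measurable]:
  "interaction_kernel p q \<in> borel_measurable borel"
  unfolding interaction_kernel_def[abs_def] by measurable

lemma interaction_kernel_nonzero:
  assumes "p < 0" "q > 0" "x \<noteq> 0"
  shows "interaction_kernel p q x =
    ennreal (1 / q) * ennreal (norm x powr q) + ennreal (1 / - p) * ennreal (norm x powr p)"
proof -
  have "norm x powr q / q - norm x powr p / p = 1 / q * norm x powr q + 1 / - p * norm x powr p" by simp
  then have "interaction_kernel p q x = ennreal (1 / q * norm x powr q + 1 / - p * norm x powr p)"
    using assms by (simp only: interaction_kernel_def if_False)
  also have "\<dots> = ennreal (1 / q * norm x powr q) + ennreal (1 / - p * norm x powr p)"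
    using assms by (intro ennreal_plus mult_nonneg_nonneg) auto
  also have "\<dots> = ennreal (1 / q) * ennreal (norm x powr q) + ennreal (1 / - p) * ennreal (norm x powr p)"
    using assms by (intro arg_cong2[where f="(+)"] ennreal_mult) auto
  finally show ?thesis .
qed

text \<open>
  The factor in front of the kernel has to serve both powers. As \<open>(1 - \<delta>) powr p\<close> and \<open>(1 + \<delta>) powr q\<close> are
  at least 1, adding the two individual factors and subtracting 1 dominates each of them, and
  the result tends to 1 as \<open>\<delta> \<rightarrow> 0\<close>. At \<open>x = 0\<close> the right-hand side is infinite.
\<close>

lemma nn_integral_mollified_interaction_kernel_le:
  fixes \<psi> :: "'a::euclidean_space \<Rightarrow> ennreal" and p q \<delta> A J :: real
  assumes [measurable]: "\<psi> \<in> borel_measurable borel" and mass: "(\<integral>\<^sup>+w. \<psi> w \<partial>lborel) = 1"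
    and le: "\<And>w. w \<noteq> 0 \<Longrightarrow> \<psi> w \<le> ennreal (A * norm w powr (- real DIM('a)))"
    and "A \<ge> 0" "p < 0" "q > 0" and \<delta>: "0 < \<delta>" "\<delta> \<le> 1/2" and "J \<ge> 0"
    and J: "(\<integral>\<^sup>+v. indicator (ball 0 1) v * ennreal (norm (v::'a) powr p) \<partial>lborel) = ennreal J"
    and M: "(\<integral>\<^sup>+w. ennreal (norm w powr q) * \<psi> w \<partial>lborel) \<le> ennreal M"
  shows "(\<integral>\<^sup>+w. interaction_kernel p q (x - w) * \<psi> w \<partial>lborel) \<le>
     ennreal ((1 - \<delta>) powr p + A * 2 ^ DIM('a) * J * \<delta> powr (p + DIM('a)) + (1 + \<delta>) powr q - 1)
       * interaction_kernel p q x
     + ennreal ((1 + 1 / \<delta>) powr q / q + \<delta> powr (p - q) / (- p)) *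
       (ennreal M + ennreal (norm x powr p) * min 1 (ennreal (norm x powr (- q)) * ennreal M))"
proof -
  define c where "c = (1 - \<delta>) powr p + A * 2 ^ DIM('a) * J * \<delta> powr (p + DIM('a)) + (1 + \<delta>) powr q - 1"
  define D where "D = (1 + 1 / \<delta>) powr q / q + \<delta> powr (p - q) / (- p)"
  have c1: "1 \<le> (1 - \<delta>) powr p" using powr_mono'[of p 0 "1 - \<delta>"] \<delta> \<open>p < 0\<close> by simp
  have c2: "1 \<le> (1 + \<delta>) powr q" using \<delta> \<open>q > 0\<close> by (intro ge_one_powr_ge_zero) auto
  have c3: "0 \<le> A * 2 ^ DIM('a) * J * \<delta> powr (p + DIM('a))" using \<open>A \<ge> 0\<close> \<open>J \<ge> 0\<close> by simp
  have "c > 0" using c1 c2 c3 by (simp add: c_def)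
  show ?thesis
  proof (cases "x = 0")
    case True
    then show ?thesis using \<open>c > 0\<close> by (simp add: c_def[symmetric] interaction_kernel_def ennreal_mult_top)
  next
    case False
    define a where "a = norm x powr p"
    define b where "b = norm x powr q"
    define m where "m = min 1 (ennreal (norm x powr (- q)) * ennreal M)"
    \<comment> \<open>At \<open>w = x\<close> the kernel is infinite while \<open>powr\<close> takes the value 0; the density does not charge this point.\<close>
    have "AE w in lborel. w \<noteq> x" by (rule AE_lborel_singleton)
    then have "(\<integral>\<^sup>+w. interaction_kernel p q (x - w) * \<psi> w \<partial>lborel) =
       (\<integral>\<^sup>+w. ennreal (1 / q) * (ennreal (norm (x - w) powr q) * \<psi> w)
             + ennreal (1 / - p) * (ennreal (norm (x - w) powr p) * \<psi> w) \<partial>lborel)"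
    proof (intro nn_integral_cong_AE, eventually_elim)
      case (elim w)
      then have "interaction_kernel p q (x - w) =
          ennreal (1 / q) * ennreal (norm (x - w) powr q) + ennreal (1 / - p) * ennreal (norm (x - w) powr p)"
        using \<open>p < 0\<close> \<open>q > 0\<close> by (intro interaction_kernel_nonzero) auto
      then show ?case by (simp add: distrib_right mult.assoc)
    qed
    also have "\<dots> = ennreal (1 / q) * (\<integral>\<^sup>+w. ennreal (norm (x - w) powr q) * \<psi> w \<partial>lborel)
             + ennreal (1 / - p) * (\<integral>\<^sup>+w. ennreal (norm (x - w) powr p) * \<psi> w \<partial>lborel)"
      by (subst nn_integral_add) (simp_all add: nn_integral_cmult)
    also have "\<dots> \<le> ennreal (1 / q) * (ennreal ((1 + \<delta>) powr q * b) + ennreal ((1 + 1 / \<delta>) powr q) * ennreal M)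
       + ennreal (1 / - p) * (ennreal (((1 - \<delta>) powr p + A * 2 ^ DIM('a) * J * \<delta> powr (p + DIM('a))) * a)
          + ennreal (\<delta> powr (p - q) * a) * m)"
      unfolding a_def b_def m_def using assms(4-) False
      by (intro add_mono mult_left_mono
           order_trans[OF nn_integral_mollified_positive_power_le[where q=q and \<delta>=\<delta>, OF assms(1) mass]]
           order_trans[OF nn_integral_mollified_negative_power_le[where A=A and p=p and q=q and \<delta>=\<delta> and J=J, OF assms(1) mass le]]
           min.mono mult_left_mono M) auto
    also have "\<dots> \<le> ennreal (1 / q) * (ennreal (c * b) + ennreal ((1 + 1 / \<delta>) powr q) * ennreal M)
       + ennreal (1 / - p) * (ennreal (c * a) + ennreal (\<delta> powr (p - q) * a) * m)"
      using c1 c2 c3 by (intro add_mono mult_left_mono ennreal_leI mult_right_mono order_refl) (auto simp: c_def a_def b_def)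
    also have "\<dots> = ennreal c * interaction_kernel p q x
        + (ennreal ((1 + 1 / \<delta>) powr q / q) * ennreal M + ennreal (\<delta> powr (p - q) / (- p)) * (ennreal a * m))"
    proof -
      have "interaction_kernel p q x = ennreal (1 / q) * ennreal b + ennreal (1 / - p) * ennreal a"
        unfolding a_def b_def using False \<open>p < 0\<close> \<open>q > 0\<close> by (intro interaction_kernel_nonzero)
      moreover have "ennreal ((1 + 1 / \<delta>) powr q / q) = ennreal (1 / q) * ennreal ((1 + 1 / \<delta>) powr q)"
        using \<open>q > 0\<close> by (subst ennreal_mult[symmetric]) auto
      moreover have "ennreal (\<delta> powr (p - q) / (- p)) = ennreal (1 / - p) * ennreal (\<delta> powr (p - q))"
        using \<open>p < 0\<close> by (subst ennreal_mult[symmetric]) (auto simp: divide_nonneg_neg)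
      moreover have "ennreal (c * b) = ennreal c * ennreal b" "ennreal (c * a) = ennreal c * ennreal a"
          "ennreal (\<delta> powr (p - q) * a) = ennreal (\<delta> powr (p - q)) * ennreal a"
        using \<open>c > 0\<close> by (simp_all add: ennreal_mult a_def b_def)
      ultimately show ?thesis by (simp only: distrib_left ac_simps)
    qed
    also have "\<dots> \<le> ennreal c * interaction_kernel p q x + ennreal D * (ennreal M + ennreal a * m)"
      unfolding distrib_left using \<open>p < 0\<close> \<open>q > 0\<close>
      by (intro add_left_mono add_mono mult_right_mono ennreal_leI) (auto simp: D_def divide_nonneg_neg)
    finally show ?thesis unfolding c_def D_def a_def m_def .
  qed
qed

section \<open>Lower truncations of the kernel\<close>

lemma uniformly_continuous_on_UNIV_if_eventually_constant:
  fixes f :: "'a::euclidean_space \<Rightarrow> real"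
  assumes cont: "continuous_on UNIV f" and const: "\<And>x. norm x > R \<Longrightarrow> f x = c"
  shows "uniformly_continuous_on UNIV f"
  unfolding uniformly_continuous_on_def
proof (intro allI impI)
  fix e :: real assume "e > 0"
  have "uniformly_continuous_on (cball 0 (R + 1)) f"
    by (intro compact_uniformly_continuous continuous_on_subset[OF cont]) auto
  then obtain d where "d > 0" and d: "\<And>x y. norm x \<le> R + 1 \<Longrightarrow> norm y \<le> R + 1 \<Longrightarrow> dist y x < d \<Longrightarrow> dist (f y) (f x) < e"
    unfolding uniformly_continuous_on_def using \<open>e > 0\<close> by (metis mem_cball_0)
  have "dist (f y) (f x) < e" if "dist y x < min d 1" for x y
  proof (cases "norm x > R \<and> norm y > R")
    case True
    then show ?thesis using const \<open>e > 0\<close> by simp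
  next
    case False
    have "norm x \<le> norm y + dist y x" "norm y \<le> norm x + dist y x"
      using norm_triangle_ineq2[of x y] norm_triangle_ineq2[of y x] by (auto simp: dist_norm norm_minus_commute)
    then show ?thesis using False that by (intro d) auto
  qed
  then show "\<exists>d>0. \<forall>x\<in>UNIV. \<forall>x'\<in>UNIV. dist x' x < d \<longrightarrow> dist (f x') (f x) < e"
    using \<open>d > 0\<close> by (intro exI[of _ "min d 1"]) auto
qed

text \<open>
  The real-valued version of \<open>min n K\<close>. The value at the origin is prescribed because \<open>K\<close> is infinite there,
  whereas \<open>0 powr p = 0\<close>.
\<close>

definition truncated_kernel :: "real \<Rightarrow> real \<Rightarrow> real \<Rightarrow> 'a::euclidean_space \<Rightarrow> real" where
  "truncated_kernel p q n x = (if x = 0 then n else min n (norm x powr q / q - norm x powr p / p))"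

lemma truncated_kernel_nonneg:
  assumes "n \<ge> 0" "p < 0" "q > 0"
  shows "0 \<le> truncated_kernel p q n x"
proof -
  have "0 \<le> norm x powr q / q" "norm x powr p / p \<le> 0"
    using assms by (auto simp: divide_nonneg_neg)
  then have "0 \<le> norm x powr q / q - norm x powr p / p" by linarith
  then show ?thesis using assms by (simp add: truncated_kernel_def)
qed

lemma ennreal_truncated_kernel:
  assumes "n \<ge> 0" "p < 0" "q > 0"
  shows "ennreal (truncated_kernel p q n x) = min (ennreal n) (interaction_kernel p q x)"
proof -
  have "0 \<le> norm x powr q / q" "norm x powr p / p \<le> 0"
    using assms by (auto simp: divide_nonneg_neg)
  then have "0 \<le> norm x powr q / q - norm x powr p / p" by linarith
  then show ?thesis
    using assms by (auto simp: truncated_kernel_def interaction_kernel_def min_def ennreal_le_iff)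
qed

text \<open>
  \<open>K\<close> exceeds \<open>n\<close> both near the origin, through the negative power, and far away from it, through the positive
  one. Hence the truncation is constant near the only discontinuity of the formula and outside a compact set.
\<close>

lemma uniformly_continuous_truncated_kernel:
  assumes n: "n > 0" "p < 0" "q > 0"
  shows "uniformly_continuous_on UNIV (truncated_kernel p q n :: 'a::euclidean_space \<Rightarrow> real)"
proof (rule uniformly_continuous_on_UNIV_if_eventually_constant)
  define k where "k = (\<lambda>x::'a. norm x powr q / q - norm x powr p / p)"
  have q_part: "0 \<le> norm x powr q / q" and p_part: "0 \<le> - (norm x powr p / p)" for x :: 'a
    using n by (auto simp: divide_nonneg_neg)
  define r where "r = (n * (- p)) powr (1 / p)"
  have "r > 0" using n by (simp add: r_def)
  have near: "truncated_kernel p q n x = n" if "norm x < r" for x :: 'a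
  proof (cases "x = 0")
    case False
    have "n * (- p) = r powr p" using n mult_pos_neg[of n p] by (simp add: r_def powr_powr)
    also have "\<dots> \<le> norm x powr p" using that False n by (intro powr_mono2') auto
    finally have "n \<le> - (norm x powr p / p)" using n by (simp add: field_simps)
    then show ?thesis using q_part[of x] by (simp add: truncated_kernel_def)
  qed (simp add: truncated_kernel_def)
  show "continuous_on UNIV (truncated_kernel p q n :: 'a \<Rightarrow> real)"
  proof -
    have "continuous_on (ball 0 r) (truncated_kernel p q n :: 'a \<Rightarrow> real)"
      using near by (subst continuous_on_cong[OF refl, of _ _ "\<lambda>_. n"]) auto
    moreover have "continuous_on (- {0}) (truncated_kernel p q n :: 'a \<Rightarrow> real)"
    proof (subst continuous_on_cong[OF refl])
      show "continuous_on (- {0}) (\<lambda>x::'a. min n (norm x powr q / q - norm x powr p / p))"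
        using n by (intro continuous_intros) auto
    qed (simp add: truncated_kernel_def)
    ultimately have "continuous_on (ball 0 r \<union> - {0}) (truncated_kernel p q n :: 'a \<Rightarrow> real)"
      by (intro continuous_on_open_Un) auto
    moreover have "ball 0 r \<union> - {0} = (UNIV :: 'a set)" using \<open>r > 0\<close> by auto
    ultimately show ?thesis by simp
  qed
  fix x :: 'a assume far: "norm x > (n * q) powr (1 / q)"
  then have "((n * q) powr (1 / q)) powr q \<le> norm x powr q" using n by (intro powr_mono2) auto
  then have "n * q \<le> norm x powr q" using n by (simp add: powr_powr)
  then have "n \<le> norm x powr q / q" using n by (simp add: field_simps)
  moreover have "x \<noteq> 0" using far by (metis norm_zero not_less powr_ge_zero)
  ultimately show "truncated_kernel p q n x = n"
    using p_part[of x] by (simp add: truncated_kernel_def)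
qed

text \<open>
  With \<open>d\<close> a modulus of continuity of the truncation for \<open>\<eta>\<close>, either the two arguments differ by less than \<open>d\<close>, or
  one of the three displacements is at least \<open>d / 3\<close>. In the second case the displacement term alone
  exceeds the bound \<open>n\<close> of the truncation. The exponents are those of the transport cost and
  of the available moment of the mollifier.
\<close>

lemma truncated_kernel_perturbation:
  fixes p q n \<eta> :: real
  assumes "n > 0" "p < 0" "q > 0" "\<eta> > 0"
  shows "\<exists>B\<ge>0. \<forall>x x' y y' w :: 'a::euclidean_space.
    ennreal (truncated_kernel p q n (x' - y')) \<le> interaction_kernel p q (x - y - w) +
      ennreal (\<eta> + B * (norm (x - x'))\<^sup>2 + B * (norm (y - y'))\<^sup>2 + B * norm w powr q)"
proof -
  have "uniformly_continuous_on UNIV (truncated_kernel p q n :: 'a \<Rightarrow> real)"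
    by (rule uniformly_continuous_truncated_kernel) (use assms in auto)
  then obtain d where "d > 0" and d: "\<And>a b :: 'a. norm (a - b) < d \<Longrightarrow>
      \<bar>truncated_kernel p q n a - truncated_kernel p q n b\<bar> < \<eta>"
    unfolding uniformly_continuous_on_def dist_norm real_norm_def using \<open>\<eta> > 0\<close> by (metis UNIV_I)
  define B where "B = n * max ((3 / d)\<^sup>2) ((3 / d) powr q)"
  have "B \<ge> 0" using assms by (simp add: B_def le_max_iff_disj)
  have B1: "n \<le> B * t\<^sup>2" if "d / 3 \<le> t" for t
  proof -
    have "1 \<le> (3 / d * t)\<^sup>2" using that \<open>d > 0\<close> by (intro one_le_power) (simp add: field_simps)
    then have "n * 1 \<le> n * ((3 / d)\<^sup>2 * t\<^sup>2)" using assms by (intro mult_left_mono) (auto simp: power_mult_distrib[symmetric])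
    also have "\<dots> \<le> B * t\<^sup>2" unfolding B_def mult.assoc using assms by (intro mult_left_mono mult_right_mono) auto
    finally show ?thesis by simp
  qed
  have B2: "n \<le> B * t powr q" if "d / 3 \<le> t" for t
  proof -
    have "1 \<le> (3 / d * t) powr q" using that \<open>d > 0\<close> assms by (intro ge_one_powr_ge_zero) (auto simp: field_simps)
    then have "n * 1 \<le> n * ((3 / d) powr q * t powr q)"
      using assms that \<open>d > 0\<close> by (intro mult_left_mono) (auto simp: powr_mult[symmetric])
    also have "\<dots> \<le> B * t powr q" unfolding B_def mult.assoc using assms by (intro mult_left_mono mult_right_mono) auto
    finally show ?thesis by simp
  qed
  have "ennreal (truncated_kernel p q n (x' - y')) \<le> interaction_kernel p q (x - y - w) +
      ennreal (\<eta> + B * (norm (x - x'))\<^sup>2 + B * (norm (y - y'))\<^sup>2 + B * norm w powr q)" for x x' y y' w :: 'a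
  proof -
    define s where "s = \<eta> + B * (norm (x - x'))\<^sup>2 + B * (norm (y - y'))\<^sup>2 + B * norm w powr q"
    have nonneg: "0 \<le> B * (norm (x - x'))\<^sup>2" "0 \<le> B * (norm (y - y'))\<^sup>2" "0 \<le> B * norm w powr q"
      using \<open>B \<ge> 0\<close> by auto
    then have "s \<ge> 0" using \<open>\<eta> > 0\<close> by (simp add: s_def)
    have tri: "norm ((x' - y') - (x - y - w)) \<le> norm (x - x') + norm (y - y') + norm w"
    proof -
      have "(x' - y') - (x - y - w) = - (x - x') + (y - y') + w" by simp
      then show ?thesis
        using norm_triangle_ineq[of "- (x - x') + (y - y')" w] norm_triangle_ineq[of "- (x - x')" "y - y'"]
        by (simp only: norm_minus_cancel)
    qed
    consider "norm ((x' - y') - (x - y - w)) < d" | "d / 3 \<le> norm (x - x')" | "d / 3 \<le> norm (y - y')" | "d / 3 \<le> norm w"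
      using tri by linarith
    then have "truncated_kernel p q n (x' - y') \<le> truncated_kernel p q n (x - y - w) + s \<or> truncated_kernel p q n (x' - y') \<le> s"
    proof cases
      case 1
      then show ?thesis using d[OF 1] nonneg by (auto simp: s_def)
    next
      case 2
      have "truncated_kernel p q n (x' - y') \<le> n" by (simp add: truncated_kernel_def)
      then show ?thesis using B1[OF 2] nonneg \<open>\<eta> > 0\<close> by (auto simp: s_def)
    next
      case 3
      have "truncated_kernel p q n (x' - y') \<le> n" by (simp add: truncated_kernel_def)
      then show ?thesis using B1[OF 3] nonneg \<open>\<eta> > 0\<close> by (auto simp: s_def)
    next
      case 4
      have "truncated_kernel p q n (x' - y') \<le> n" by (simp add: truncated_kernel_def)
      then show ?thesis using B2[OF 4] nonneg \<open>\<eta> > 0\<close> by (auto simp: s_def)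
    qed
    then have "ennreal (truncated_kernel p q n (x' - y')) \<le> ennreal (truncated_kernel p q n (x - y - w)) + ennreal s"
    proof
      assume "truncated_kernel p q n (x' - y') \<le> truncated_kernel p q n (x - y - w) + s"
      then have "ennreal (truncated_kernel p q n (x' - y')) \<le> ennreal (truncated_kernel p q n (x - y - w) + s)"
        by (rule ennreal_leI)
      also have "\<dots> \<le> ennreal (truncated_kernel p q n (x - y - w)) + ennreal s" 
        using truncated_kernel_nonneg[of n p q] assms \<open>s \<ge> 0\<close> by (subst ennreal_plus) auto
      finally show ?thesis .
    next
      assume "truncated_kernel p q n (x' - y') \<le> s"
      then show ?thesis by (intro add_increasing ennreal_leI) auto
    qed
    also have "\<dots> \<le> interaction_kernel p q (x - y - w) + ennreal s"
      using assms by (intro add_right_mono) (simp add: ennreal_truncated_kernel)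
    finally show ?thesis unfolding s_def .
  qed
  then show ?thesis using \<open>B \<ge> 0\<close> by blast
qed

section \<open>Lower semicontinuity\<close>

lemma prob_space_coupling:
  assumes "\<gamma> \<in> couplings \<nu> \<mu>" "prob_space \<nu>"
  shows "prob_space \<gamma>"
proof (rule prob_spaceI)
  interpret N: prob_space \<nu> by fact
  have s: "sets \<gamma> = sets (borel \<Otimes>\<^sub>M borel)" and d: "distr \<gamma> borel fst = \<nu>"
    using assms by (auto simp: couplings_def)
  have "fst \<in> \<gamma> \<rightarrow>\<^sub>M borel" by (simp add: measurable_cong_sets[OF s refl])
  then have "emeasure (distr \<gamma> borel fst) (space borel) = emeasure \<gamma> (fst -` space borel \<inter> space \<gamma>)"
    by (intro emeasure_distr) auto
  moreover have "space \<nu> = space borel" using d by (metis space_distr)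
  ultimately show "emeasure \<gamma> (space \<gamma>) = 1" using N.emeasure_space_1 d by simp
qed

text \<open>
  The pointwise inequality is integrated over two independent copies of the coupling and over \<open>\<psi>\<close>. The function
  \<open>f\<close> only sees the second marginal \<open>\<mu>\<close>, the mollified kernel only the first one, and the two
  displacement terms each give one transport cost.
\<close>

lemma energy_mollified_lower_bound:
  fixes \<nu> \<mu> :: "'a::euclidean_space measure" and \<psi> K :: "'a \<Rightarrow> ennreal" and f :: "'a \<Rightarrow> ennreal"
  assumes \<gamma>: "\<gamma> \<in> couplings \<nu> \<mu>" and "prob_space \<nu>"
    and [measurable]: "\<psi> \<in> borel_measurable borel" "K \<in> borel_measurable borel" "f \<in> borel_measurable borel"
    and mass: "(\<integral>\<^sup>+w. \<psi> w \<partial>lborel) = 1" and "\<eta> \<ge> 0" "B \<ge> 0"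
    and le: "\<And>x x' y y' w. f (x' - y') \<le> K (x - y - w) +
      ennreal (\<eta> + B * (norm (x - x'))\<^sup>2 + B * (norm (y - y'))\<^sup>2 + B * norm w powr q)"
  shows "energy f \<mu> \<le> energy (\<lambda>v. \<integral>\<^sup>+w. K (v - w) * \<psi> w \<partial>lborel) \<nu> + (ennreal \<eta> +
    (ennreal B * (\<integral>\<^sup>+z. ennreal ((norm (fst z - snd z))\<^sup>2) \<partial>\<gamma>) + (ennreal B * (\<integral>\<^sup>+z. ennreal ((norm (fst z - snd z))\<^sup>2) \<partial>\<gamma>) +
     ennreal B * (\<integral>\<^sup>+w. ennreal (norm w powr q) * \<psi> w \<partial>lborel))))"
proof -
  have s [measurable_cong]: "sets \<gamma> = sets (borel \<Otimes>\<^sub>M borel)" and d1: "\<nu> = distr \<gamma> borel fst" and d2: "\<mu> = distr \<gamma> borel snd"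
    using \<gamma> by (auto simp: couplings_def)
  interpret \<gamma>: prob_space \<gamma> using prob_space_coupling[OF \<gamma>] \<open>prob_space \<nu>\<close> .
  define L where "L v = (\<integral>\<^sup>+w. K (v - w) * \<psi> w \<partial>lborel)" for v
  define M where "M = (\<integral>\<^sup>+w. ennreal (norm w powr q) * \<psi> w \<partial>lborel)"
  define c where "c z = ennreal ((norm (fst z - snd z))\<^sup>2)" for z :: "'a \<times> 'a"
  have [measurable]: "L \<in> borel_measurable borel" unfolding L_def[abs_def] by measurable
  have [measurable]: "c \<in> borel_measurable (borel \<Otimes>\<^sub>M borel)" unfolding c_def[abs_def] by measurable
  have inner: "f (snd z - snd z') \<le> L (fst z - fst z') + (ennreal \<eta> + (ennreal B * c z + (ennreal B * c z' + ennreal B * M)))" for z z'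
  proof -
    define t where "t = ennreal \<eta> + (ennreal B * c z + ennreal B * c z')"
    have "f (snd z - snd z') = (\<integral>\<^sup>+w. f (snd z - snd z') * \<psi> w \<partial>lborel)"
      by (simp add: nn_integral_cmult mass)
    also have "\<dots> \<le> (\<integral>\<^sup>+w. K (fst z - fst z' - w) * \<psi> w + (t * \<psi> w + ennreal B * (ennreal (norm w powr q) * \<psi> w)) \<partial>lborel)"
    proof (rule nn_integral_mono)
      fix w
      have "f (snd z - snd z') \<le> K (fst z - fst z' - w) + (t + ennreal B * ennreal (norm w powr q))"
        using le[of "snd z" "snd z'" "fst z" "fst z'" w] \<open>\<eta> \<ge> 0\<close> \<open>B \<ge> 0\<close>
        by (simp add: t_def c_def ennreal_mult add.assoc)
      from mult_right_mono[OF this, of "\<psi> w"]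
      show "f (snd z - snd z') * \<psi> w \<le> K (fst z - fst z' - w) * \<psi> w + (t * \<psi> w + ennreal B * (ennreal (norm w powr q) * \<psi> w))"
        by (simp add: distrib_right mult.assoc)
    qed
    also have "\<dots> = L (fst z - fst z') + (t + ennreal B * M)"
      by (simp add: nn_integral_add nn_integral_cmult mass L_def M_def)
    finally show ?thesis by (simp add: t_def add.assoc)
  qed
  have "energy f \<mu> = (\<integral>\<^sup>+z. \<integral>\<^sup>+z'. f (snd z - snd z') \<partial>\<gamma> \<partial>\<gamma>)"
    unfolding energy_def d2 by (simp add: nn_integral_distr)
  also have "\<dots> \<le> (\<integral>\<^sup>+z. \<integral>\<^sup>+z'. L (fst z - fst z') + (ennreal \<eta> + (ennreal B * c z + (ennreal B * c z' + ennreal B * M))) \<partial>\<gamma> \<partial>\<gamma>)"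
    by (intro nn_integral_mono inner)
  also have "\<dots> = (\<integral>\<^sup>+z. (\<integral>\<^sup>+z'. L (fst z - fst z') \<partial>\<gamma>) + (ennreal \<eta> + (ennreal B * c z + (ennreal B * integral\<^sup>N \<gamma> c + ennreal B * M))) \<partial>\<gamma>)"
    by (simp add: nn_integral_add nn_integral_cmult \<gamma>.emeasure_space_1)
  also have "\<dots> = (\<integral>\<^sup>+z. (\<integral>\<^sup>+z'. L (fst z - fst z') \<partial>\<gamma>) \<partial>\<gamma>) + (ennreal \<eta> + (ennreal B * integral\<^sup>N \<gamma> c + (ennreal B * integral\<^sup>N \<gamma> c + ennreal B * M)))"
    by (simp add: nn_integral_add nn_integral_cmult \<gamma>.emeasure_space_1)
  also have "(\<integral>\<^sup>+z. (\<integral>\<^sup>+z'. L (fst z - fst z') \<partial>\<gamma>) \<partial>\<gamma>) = energy L \<nu>"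
    unfolding energy_def d1 by (simp add: nn_integral_distr)
  finally show ?thesis unfolding L_def[abs_def] M_def c_def .
qed

lemma energy_eq_SUP_truncated:
  fixes \<mu> :: "'a::euclidean_space measure"
  assumes [measurable_cong]: "sets \<mu> = sets borel" and "sigma_finite_measure \<mu>"
    and [measurable]: "K \<in> borel_measurable borel"
  shows "energy K \<mu> = (SUP n::nat. energy (\<lambda>x. min (ennreal (real n)) (K x)) \<mu>)"
proof -
  interpret sigma_finite_measure \<mu> by fact
  have sup: "K x = (SUP n::nat. min (ennreal (real n)) (K x))" for x
  proof (rule antisym)
    show "K x \<le> (SUP n::nat. min (ennreal (real n)) (K x))"
    proof (cases "K x" rule: ennreal_cases)
      case (real r)
      obtain n :: nat where "r \<le> real n" using real_arch_simple by blast
      then have "K x = min (ennreal (real n)) (K x)" using real by (simp add: min_def ennreal_leI)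
      also have "\<dots> \<le> (SUP n::nat. min (ennreal (real n)) (K x))" by (rule SUP_upper) simp
      finally show ?thesis .
    next
      case top
      then show ?thesis by (simp add: ennreal_SUP_of_nat_eq_top ennreal_of_nat_eq_real_of_nat[symmetric])
    qed
  qed (simp add: SUP_least)
  have inc: "incseq (\<lambda>n::nat. min (ennreal (real n)) (K x))" for x
    by (intro incseq_SucI min.mono ennreal_leI) auto
  have "energy K \<mu> = (\<integral>\<^sup>+x. \<integral>\<^sup>+y. (SUP n::nat. min (ennreal (real n)) (K (x - y))) \<partial>\<mu> \<partial>\<mu>)"
    unfolding energy_def by (subst sup) simp
  also have "\<dots> = (\<integral>\<^sup>+x. (SUP n::nat. \<integral>\<^sup>+y. min (ennreal (real n)) (K (x - y)) \<partial>\<mu>) \<partial>\<mu>)"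
    using inc by (intro nn_integral_cong nn_integral_monotone_convergence_SUP) (auto simp: incseq_def le_fun_def)
  also have "\<dots> = (SUP n::nat. energy (\<lambda>x. min (ennreal (real n)) (K x)) \<mu>)"
    unfolding energy_def using inc
    by (intro nn_integral_monotone_convergence_SUP) (auto simp: incseq_def le_fun_def intro!: nn_integral_mono)
  finally show ?thesis .
qed

lemma eventually_wasserstein_cost_less:
  fixes u :: "real \<Rightarrow> 'a::euclidean_space measure"
  assumes "\<And>\<epsilon>. \<epsilon> > 0 \<Longrightarrow> u \<epsilon> \<in> P2" "\<mu> \<in> P2" "((\<lambda>\<epsilon>. d_W (u \<epsilon>) \<mu>) \<longlongrightarrow> 0) (at_right 0)" "t > 0"
  shows "\<forall>\<^sub>F \<epsilon> in at_right 0. wasserstein_cost (u \<epsilon>) \<mu> < ennreal t"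
proof -
  have "\<forall>\<^sub>F \<epsilon> in at_right 0. d_W (u \<epsilon>) \<mu> < sqrt t"
    using assms(3,4) by (intro order_tendstoD) auto
  moreover have "\<forall>\<^sub>F \<epsilon> in at_right 0. (0::real) < \<epsilon>" by (rule eventually_at_right_less)
  ultimately show ?thesis
  proof eventually_elim
    case (elim \<epsilon>)
    have "wasserstein_cost (u \<epsilon>) \<mu> < \<infinity>" using elim assms by (intro wasserstein_cost_finite) auto
    then show ?case using elim by (simp add: d_W_def enn2real_less_iff)
  qed
qed

text \<open>
  It suffices to bound the energy of each truncation. Given \<open>e\<close>, one half of it pays for the modulus of
  continuity \<open>\<eta>\<close>, and the other half for the two transport costs and the moment, which are eventually below
  the threshold \<open>t\<close> with \<open>3 * (B * t) \<le> e / 2\<close>.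
\<close>

lemma energy_liminf:
  fixes \<psi> :: "real \<Rightarrow> 'a::euclidean_space \<Rightarrow> ennreal" and u :: "real \<Rightarrow> 'a measure" and p q :: real
  assumes "p < 0" "q > 0"
    and meas: "\<And>\<epsilon>. \<psi> \<epsilon> \<in> borel_measurable borel"
    and mass: "\<And>\<epsilon>. \<epsilon> > 0 \<Longrightarrow> (\<integral>\<^sup>+w. \<psi> \<epsilon> w \<partial>lborel) = 1"
    and moment: "((\<lambda>\<epsilon>. \<integral>\<^sup>+w. ennreal (norm w powr q) * \<psi> \<epsilon> w \<partial>lborel) \<longlongrightarrow> 0) (at_right 0)"
    and u: "\<And>\<epsilon>. \<epsilon> > 0 \<Longrightarrow> u \<epsilon> \<in> P2" and \<mu>: "\<mu> \<in> P2" and lim: "((\<lambda>\<epsilon>. d_W (u \<epsilon>) \<mu>) \<longlongrightarrow> 0) (at_right 0)"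
  shows "energy (interaction_kernel p q) \<mu> \<le>
    Liminf (at_right 0) (\<lambda>\<epsilon>. energy (\<lambda>v. \<integral>\<^sup>+w. interaction_kernel p q (v - w) * \<psi> \<epsilon> w \<partial>lborel) (u \<epsilon>))"
proof -
  define E where "E \<epsilon> = energy (\<lambda>v. \<integral>\<^sup>+w. interaction_kernel p q (v - w) * \<psi> \<epsilon> w \<partial>lborel) (u \<epsilon>)" for \<epsilon>
  have s [measurable_cong]: "sets \<mu> = sets borel" and prob: "prob_space \<mu>"
    using \<mu> by (auto simp: P2_def)
  interpret prob_space \<mu> by fact
  have "energy (\<lambda>x. min (ennreal (real n)) (interaction_kernel p q x)) \<mu> \<le> Liminf (at_right 0) E" for n
  proof (cases "n = 0")
    case True
    then show ?thesis by (simp add: energy_def)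
  next
    case False
    show ?thesis
    proof (rule ennreal_le_epsilon)
      fix e :: real assume "e > 0"
      define \<eta> where "\<eta> = e / 2"
      have "\<eta> > 0" using \<open>e > 0\<close> by (simp add: \<eta>_def)
      have "real n > 0" using False by simp
      then obtain B where B: "B \<ge> 0" "\<And>x x' y y' w :: 'a.
        ennreal (truncated_kernel p q (real n) (x' - y')) \<le> interaction_kernel p q (x - y - w) +
          ennreal (\<eta> + B * (norm (x - x'))\<^sup>2 + B * (norm (y - y'))\<^sup>2 + B * norm w powr q)"
        using truncated_kernel_perturbation[OF _ assms(1,2) \<open>\<eta> > 0\<close>] by meson
      define t where "t = \<eta> / (3 * (B + 1))"
      have "t > 0" using B \<open>\<eta> > 0\<close> by (simp add: t_def)
      have Bt: "3 * (B * t) \<le> \<eta>" using B \<open>\<eta> > 0\<close> by (simp add: t_def field_simps)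
      have "\<forall>\<^sub>F \<epsilon> in at_right 0. wasserstein_cost (u \<epsilon>) \<mu> < ennreal t"
        using u \<mu> lim \<open>t > 0\<close> by (rule eventually_wasserstein_cost_less)
      moreover have "\<forall>\<^sub>F \<epsilon> in at_right 0. (\<integral>\<^sup>+w. ennreal (norm w powr q) * \<psi> \<epsilon> w \<partial>lborel) < ennreal t"
        using moment \<open>t > 0\<close> by (intro order_tendstoD) auto
      moreover have "\<forall>\<^sub>F \<epsilon> in at_right 0. (0::real) < \<epsilon>" by (rule eventually_at_right_less)
      ultimately have "\<forall>\<^sub>F \<epsilon> in at_right 0. energy (\<lambda>x. min (ennreal (real n)) (interaction_kernel p q x)) \<mu> \<le> E \<epsilon> + ennreal e"
      proof eventually_elim
        case (elim \<epsilon>)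
        then obtain \<gamma> where \<gamma>: "\<gamma> \<in> couplings (u \<epsilon>) \<mu>"
          and cost: "(\<integral>\<^sup>+z. ennreal ((norm (fst z - snd z))\<^sup>2) \<partial>\<gamma>) < ennreal t"
          unfolding wasserstein_cost_def INF_less_iff by auto
        have "prob_space (u \<epsilon>)" using u[of \<epsilon>] elim by (simp add: P2_def)
        have "energy (\<lambda>x. min (ennreal (real n)) (interaction_kernel p q x)) \<mu> \<le> E \<epsilon> + (ennreal \<eta> +
            (ennreal B * (\<integral>\<^sup>+z. ennreal ((norm (fst z - snd z))\<^sup>2) \<partial>\<gamma>) +
            (ennreal B * (\<integral>\<^sup>+z. ennreal ((norm (fst z - snd z))\<^sup>2) \<partial>\<gamma>) +
             ennreal B * (\<integral>\<^sup>+w. ennreal (norm w powr q) * \<psi> \<epsilon> w \<partial>lborel))))"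
          unfolding E_def
        proof (rule energy_mollified_lower_bound[OF \<gamma>])
          show "min (ennreal (real n)) (interaction_kernel p q (x' - y')) \<le> interaction_kernel p q (x - y - w) +
            ennreal (\<eta> + B * (norm (x - x'))\<^sup>2 + B * (norm (y - y'))\<^sup>2 + B * norm w powr q)" for x x' y y' w :: 'a
            using B(2)[of x' y' x y w] assms(1,2) by (simp add: ennreal_truncated_kernel)
        qed (use meas mass elim \<open>prob_space (u \<epsilon>)\<close> \<open>\<eta> > 0\<close> B in auto)
        also have "\<dots> \<le> E \<epsilon> + (ennreal \<eta> + (ennreal B * ennreal t + (ennreal B * ennreal t + ennreal B * ennreal t)))"
          using cost elim by (intro add_mono mult_left_mono order_refl) auto
        also have "\<dots> = E \<epsilon> + ennreal (\<eta> + 3 * (B * t))"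
          using B \<open>\<eta> > 0\<close> \<open>t > 0\<close> by (simp add: ennreal_mult[symmetric] ennreal_plus[symmetric] del: ennreal_plus)
        also have "\<dots> \<le> E \<epsilon> + ennreal e"
          using Bt by (intro add_left_mono ennreal_leI) (simp add: \<eta>_def)
        finally show ?case .
      qed
      then have "energy (\<lambda>x. min (ennreal (real n)) (interaction_kernel p q x)) \<mu> \<le> Liminf (at_right 0) (\<lambda>\<epsilon>. E \<epsilon> + ennreal e)"
        by (rule Liminf_bounded)
      also have "\<dots> = Liminf (at_right 0) E + ennreal e"
      proof (rule Liminf_compose_continuous_mono[where f="\<lambda>x. x + ennreal e"])
        show "continuous_on UNIV (\<lambda>x::ennreal. x + ennreal e)"
          by (intro continuous_on_add_ennreal continuous_intros)
      qed (auto simp: mono_def add_right_mono)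
      finally show "energy (\<lambda>x. min (ennreal (real n)) (interaction_kernel p q x)) \<mu> \<le> Liminf (at_right 0) E + ennreal e" .
    qed
  qed
  then show ?thesis
    unfolding E_def[symmetric]
    by (subst energy_eq_SUP_truncated) (auto intro!: SUP_least s prob_space_imp_sigma_finite prob)
qed

section \<open>Recovery sequence and Gamma-convergence\<close>

lemma energy_pair_measure:
  fixes \<mu> :: "'a::euclidean_space measure"
  assumes [measurable_cong]: "sets \<mu> = sets borel" and "sigma_finite_measure \<mu>"
    and [measurable]: "K \<in> borel_measurable borel"
  shows "energy K \<mu> = (\<integral>\<^sup>+z. K (fst z - snd z) \<partial>(\<mu> \<Otimes>\<^sub>M \<mu>))"
proof -
  interpret sigma_finite_measure \<mu> by fact
  show ?thesis unfolding energy_def by (subst nn_integral_fst[symmetric]) auto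
qed

text \<open>
  The error term of the kernel estimate. It tends to 0 pointwise and is dominated by
  \<open>norm x powr p \<le> - p * K x\<close>, which is integrable because the energy is finite.
  At \<open>x = 0\<close> the conventions for \<open>powr\<close> make it vanish.
\<close>

lemma energy_cutoff_tendsto_0:
  fixes \<mu> :: "'a::euclidean_space measure" and p q b :: real
  assumes [measurable_cong]: "sets \<mu> = sets borel" and "prob_space \<mu>" and "p < 0" "q > 0" "b \<ge> 0"
    and fin: "energy (interaction_kernel p q) \<mu> < \<infinity>"
  shows "((\<lambda>\<epsilon>. energy (\<lambda>x. ennreal (norm x powr p) *
      min 1 (ennreal (norm x powr (- q)) * ennreal (b * \<epsilon> powr q))) \<mu>) \<longlongrightarrow> 0) (at_right 0)"
proof -
  interpret prob_space \<mu> by fact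
  have sf: "sigma_finite_measure \<mu>" by unfold_locales
  define g where "g \<epsilon> x = ennreal (norm x powr p) * min 1 (ennreal (norm x powr (- q)) * ennreal (b * \<epsilon> powr q))"
    for \<epsilon> and x :: 'a
  have [measurable]: "g \<epsilon> \<in> borel_measurable borel" for \<epsilon> unfolding g_def[abs_def] by measurable
  have dom: "g \<epsilon> x \<le> ennreal (- p) * interaction_kernel p q x" for \<epsilon> x
  proof (cases "x = 0")
    case True
    then show ?thesis by (simp add: g_def)
  next
    case False
    have "ennreal (- p) * ennreal (1 / - p) = 1"
      using \<open>p < 0\<close> by (subst ennreal_mult[symmetric]) auto
    then have scale: "ennreal (- p) * (ennreal (1 / - p) * X) = X" for X
      by (simp only: mult.assoc[symmetric] mult_1_left)
    have "g \<epsilon> x \<le> ennreal (norm x powr p) * 1" unfolding g_def by (intro mult_left_mono) auto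
    also have "\<dots> = ennreal (- p) * (ennreal (1 / - p) * ennreal (norm x powr p))"
      by (simp only: scale mult_1_right)
    also have "\<dots> \<le> ennreal (- p) * interaction_kernel p q x"
      unfolding interaction_kernel_nonzero[OF \<open>p < 0\<close> \<open>q > 0\<close> False] by (intro mult_left_mono) auto
    finally show ?thesis .
  qed
  have "(\<lambda>i. energy (g (X i)) \<mu>) \<longlonglongrightarrow> 0" if X: "\<And>i. X i > 0" "X \<longlonglongrightarrow> 0" for X :: "nat \<Rightarrow> real"
  proof -
    have "(\<lambda>i. \<integral>\<^sup>+z. g (X i) (fst z - snd z) \<partial>(\<mu> \<Otimes>\<^sub>M \<mu>)) \<longlonglongrightarrow> (\<integral>\<^sup>+z. 0 \<partial>(\<mu> \<Otimes>\<^sub>M \<mu>))"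
    proof (rule nn_integral_dominated_convergence)
      show "AE z in \<mu> \<Otimes>\<^sub>M \<mu>. g (X i) (fst z - snd z) \<le> ennreal (- p) * interaction_kernel p q (fst z - snd z)" for i
        using dom by simp
      show "(\<integral>\<^sup>+z. ennreal (- p) * interaction_kernel p q (fst z - snd z) \<partial>(\<mu> \<Otimes>\<^sub>M \<mu>)) < \<infinity>"
        using fin by (simp add: nn_integral_cmult energy_pair_measure[OF assms(1) sf, symmetric] ennreal_mult_less_top)
      have lim: "(\<lambda>i. g (X i) x) \<longlonglongrightarrow> 0" for x
      proof (rule tendsto_sandwich[where f="\<lambda>_. 0"])
        define C where "C = norm x powr p * (norm x powr (- q) * b)"
        show "\<forall>\<^sub>F i in sequentially. g (X i) x \<le> ennreal (C * X i powr q)"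
        proof (rule always_eventually, rule allI)
          fix i
          have "g (X i) x \<le> ennreal (norm x powr p) * (ennreal (norm x powr (- q)) * ennreal (b * X i powr q))"
            unfolding g_def by (intro mult_left_mono) auto
          also have "\<dots> = ennreal (C * X i powr q)"
            using \<open>b \<ge> 0\<close> by (simp add: C_def ennreal_mult[symmetric] mult.assoc)
          finally show "g (X i) x \<le> ennreal (C * X i powr q)" .
        qed
        have "(\<lambda>i. C * X i powr q) \<longlonglongrightarrow> C * 0"
          using X \<open>q > 0\<close> by (intro tendsto_mult tendsto_const tendsto_zero_powrI[where b=q] always_eventually) (auto intro: less_imp_le)
        then show "(\<lambda>i. ennreal (C * X i powr q)) \<longlonglongrightarrow> 0"
          using tendsto_ennrealI by fastforce
      qed auto
      show "AE z in \<mu> \<Otimes>\<^sub>M \<mu>. (\<lambda>i. g (X i) (fst z - snd z)) \<longlonglongrightarrow> 0"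
        using lim by simp
    qed measurable
    then show ?thesis by (simp add: energy_pair_measure[OF assms(1) sf])
  qed
  then show ?thesis
    unfolding g_def[symmetric] tendsto_at_iff_sequentially comp_def by auto
qed

text \<open>
  First \<open>\<delta>\<close> is fixed so small that \<open>c \<delta>\<close> times the energy stays below \<open>a\<close>; with \<open>\<delta>\<close> fixed, the remaining terms
  vanish as \<open>\<epsilon> \<rightarrow> 0\<close>.
\<close>

lemma energy_limsup:
  fixes \<psi> :: "real \<Rightarrow> 'a::euclidean_space \<Rightarrow> ennreal" and p q A b :: real and \<mu> :: "'a measure"
  assumes p: "- real DIM('a) < p" "p < 0" and "q > 0" "A \<ge> 0" "b \<ge> 0"
    and meas: "\<And>\<epsilon>. \<psi> \<epsilon> \<in> borel_measurable borel"
    and mass: "\<And>\<epsilon>. \<epsilon> > 0 \<Longrightarrow> (\<integral>\<^sup>+w. \<psi> \<epsilon> w \<partial>lborel) = 1"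
    and le: "\<And>\<epsilon> w. \<epsilon> > 0 \<Longrightarrow> w \<noteq> 0 \<Longrightarrow> \<psi> \<epsilon> w \<le> ennreal (A * norm w powr (- real DIM('a)))"
    and moment: "\<And>\<epsilon>. \<epsilon> > 0 \<Longrightarrow> (\<integral>\<^sup>+w. ennreal (norm w powr q) * \<psi> \<epsilon> w \<partial>lborel) \<le> ennreal (b * \<epsilon> powr q)"
    and \<mu>: "sets \<mu> = sets borel" "prob_space \<mu>"
    and less: "energy (interaction_kernel p q) \<mu> < a"
  shows "\<forall>\<^sub>F \<epsilon> in at_right 0. energy (\<lambda>v. \<integral>\<^sup>+w. interaction_kernel p q (v - w) * \<psi> \<epsilon> w \<partial>lborel) \<mu> < a"
proof -
  note [measurable_cong] = \<mu>(1)
  note [measurable] = meas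
  interpret prob_space \<mu> by fact
  interpret pair_prob_space \<mu> \<mu> ..
  have sf: "sigma_finite_measure \<mu>" by unfold_locales
  define E where "E = energy (interaction_kernel p q) \<mu>"
  have "E < \<infinity>" using less unfolding E_def by (rule order_less_le_trans) simp
  define J where "J = enn2real (\<integral>\<^sup>+v. indicator (ball 0 1) v * ennreal (norm (v::'a) powr p) \<partial>lborel)"
  have J: "(\<integral>\<^sup>+v. indicator (ball 0 1) v * ennreal (norm (v::'a) powr p) \<partial>lborel) = ennreal J" "J \<ge> 0"
    using nn_integral_norm_powr_ball_finite[where 'a='a, OF p(1)] by (simp_all add: J_def)
  define c where "c \<delta> = (1 - \<delta>) powr p + A * 2 ^ DIM('a) * J * \<delta> powr (p + DIM('a)) + (1 + \<delta>) powr q - 1" for \<delta>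
  have "((\<lambda>\<delta>. (1 - \<delta>) powr p + A * 2 ^ DIM('a) * J * \<delta> powr (p + DIM('a)) + (1 + \<delta>) powr q - 1) \<longlongrightarrow>
      (1 - 0) powr p + A * 2 ^ DIM('a) * J * 0 + (1 + 0) powr q - 1) (at_right 0)"
  proof (intro tendsto_intros)
    show "((\<lambda>\<delta>. \<delta> powr (p + DIM('a))) \<longlongrightarrow> 0) (at_right 0)"
      using p eventually_at_right_less[of "0::real"]
      by (intro tendsto_zero_powrI[where b="p + DIM('a)"] tendsto_intros) (auto elim: eventually_mono)
  qed auto
  then have "(c \<longlongrightarrow> 1) (at_right 0)" by (simp add: c_def[abs_def])
  then have "((\<lambda>\<delta>. E * ennreal (c \<delta>)) \<longlongrightarrow> E * ennreal 1) (at_right 0)"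
    using \<open>E < \<infinity>\<close> by (intro ennreal_tendsto_cmult tendsto_ennrealI) auto
  then have "\<forall>\<^sub>F \<delta> in at_right 0. E * ennreal (c \<delta>) < a"
    using less by (intro order_tendstoD) (auto simp: E_def)
  moreover have "\<forall>\<^sub>F \<delta>::real in at_right 0. 0 < \<delta>" by (rule eventually_at_right_less)
  moreover have "\<forall>\<^sub>F \<delta>::real in at_right 0. \<delta> < 1 / 2" by (intro order_tendstoD(2)[OF tendsto_ident_at]) auto
  ultimately have "\<forall>\<^sub>F \<delta> in at_right 0. E * ennreal (c \<delta>) < a \<and> 0 < \<delta> \<and> \<delta> < 1 / 2"
    by eventually_elim auto
  then obtain \<delta> where \<delta>: "E * ennreal (c \<delta>) < a" "0 < \<delta>" "\<delta> < 1 / 2"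
    using eventually_happens'[OF trivial_limit_at_right_real] by blast
  define D where "D = ennreal ((1 + 1 / \<delta>) powr q / q + \<delta> powr (p - q) / (- p))"
  define g where "g \<epsilon> x = ennreal (norm x powr p) * min 1 (ennreal (norm x powr (- q)) * ennreal (b * \<epsilon> powr q))"
    for \<epsilon> and x :: 'a
  have [measurable]: "g \<epsilon> \<in> borel_measurable borel" for \<epsilon> unfolding g_def[abs_def] by measurable
  define F where "F \<epsilon> v = (\<integral>\<^sup>+w. interaction_kernel p q (v - w) * \<psi> \<epsilon> w \<partial>lborel)" for \<epsilon> v
  have [measurable]: "F \<epsilon> \<in> borel_measurable borel" for \<epsilon> unfolding F_def[abs_def] by measurable
  have bound: "energy (F \<epsilon>) \<mu> \<le> E * ennreal (c \<delta>) + D * (ennreal (b * \<epsilon> powr q) + energy (g \<epsilon>) \<mu>)" if "\<epsilon> > 0" for \<epsilon>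
  proof -
    have "F \<epsilon> x \<le> ennreal (c \<delta>) * interaction_kernel p q x + D * (ennreal (b * \<epsilon> powr q) + g \<epsilon> x)" for x
      unfolding F_def c_def D_def g_def
      by (rule nn_integral_mollified_interaction_kernel_le)
         (use \<delta> J p assms that in auto)
    then have "energy (F \<epsilon>) \<mu> \<le> (\<integral>\<^sup>+z. ennreal (c \<delta>) * interaction_kernel p q (fst z - snd z)
        + D * (ennreal (b * \<epsilon> powr q) + g \<epsilon> (fst z - snd z)) \<partial>(\<mu> \<Otimes>\<^sub>M \<mu>))"
      unfolding energy_pair_measure[OF \<mu>(1) sf \<open>F \<epsilon> \<in> borel_measurable borel\<close>]
      by (intro nn_integral_mono)
    also have "\<dots> = ennreal (c \<delta>) * E + D * (ennreal (b * \<epsilon> powr q) + energy (g \<epsilon>) \<mu>)"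
      by (simp add: nn_integral_add nn_integral_cmult emeasure_space_1 P.emeasure_space_1 E_def energy_pair_measure[OF \<mu>(1) sf])
    finally show ?thesis by (simp add: mult.commute)
  qed
  have "((\<lambda>\<epsilon>. E * ennreal (c \<delta>) + D * (ennreal (b * \<epsilon> powr q) + energy (g \<epsilon>) \<mu>)) \<longlongrightarrow>
      E * ennreal (c \<delta>) + D * (ennreal (b * 0) + 0)) (at_right 0)"
  proof (intro tendsto_add tendsto_const ennreal_tendsto_cmult tendsto_ennrealI tendsto_mult)
    show "D < top" by (simp add: D_def)
    show "((\<lambda>\<epsilon>. \<epsilon> powr q) \<longlongrightarrow> 0) (at_right 0)"
      using \<open>q > 0\<close> eventually_at_right_less[of "0::real"]
      by (intro tendsto_zero_powrI[where b=q] tendsto_intros) (auto elim: eventually_mono)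
    show "((\<lambda>\<epsilon>. energy (g \<epsilon>) \<mu>) \<longlongrightarrow> 0) (at_right 0)"
      unfolding g_def using \<mu> p \<open>q > 0\<close> \<open>b \<ge> 0\<close> \<open>E < \<infinity>\<close> unfolding E_def
      by (intro energy_cutoff_tendsto_0)
  qed
  then have "\<forall>\<^sub>F \<epsilon> in at_right 0. E * ennreal (c \<delta>) + D * (ennreal (b * \<epsilon> powr q) + energy (g \<epsilon>) \<mu>) < a"
    using \<delta>(1) by (intro order_tendstoD(2)) auto
  then have "\<forall>\<^sub>F \<epsilon> in at_right 0. energy (F \<epsilon>) \<mu> < a"
    using eventually_at_right_less[of 0]
  proof eventually_elim
    case (elim \<epsilon>)
    then show ?case using bound[of \<epsilon>] by (meson order_le_less_trans)
  qed
  then show ?thesis unfolding F_def[abs_def] .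
qed

lemma wasserstein_cost_self:
  fixes \<mu> :: "'a::euclidean_space measure"
  assumes "\<mu> \<in> P2"
  shows "wasserstein_cost \<mu> \<mu> = 0"
proof -
  have s [measurable_cong]: "sets \<mu> = sets borel" using assms by (simp add: P2_def)
  define \<gamma> where "\<gamma> = distr \<mu> (borel \<Otimes>\<^sub>M borel) (\<lambda>x. (x, x))"
  have "distr \<mu> borel (\<lambda>x. x) = \<mu>" by (rule distr_id2) (simp add: s)
  then have "\<gamma> \<in> couplings \<mu> \<mu>"
    by (simp add: couplings_def \<gamma>_def distr_distr comp_def)
  then have "wasserstein_cost \<mu> \<mu> \<le> (\<integral>\<^sup>+z. ennreal ((norm (fst z - snd z))\<^sup>2) \<partial>\<gamma>)"
    unfolding wasserstein_cost_def by (rule INF_lower)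
  also have "\<dots> = 0" by (simp add: \<gamma>_def nn_integral_distr)
  finally show ?thesis by simp
qed

lemma smooth_imp_continuous: "smooth f \<Longrightarrow> continuous_on UNIV f"
  by (metis Ck.simps(1) smooth_def)

theorem theorem3p4:
  fixes p q l C :: real and \<phi> :: "real ^ 'd \<Rightarrow> real"
  assumes "2 - real CARD('d) \<le> p" "p < 0" "0 < q" "q \<le> 2"
    and "smooth \<phi>" "radial \<phi>" "\<And>x. 0 \<le> \<phi> x"
    and "has_bochner_integral lborel \<phi> 1"
    and "l \<ge> max (2 * real CARD('d) + 1) 4" "C > 0"
    and "\<And>x. x \<noteq> 0 \<Longrightarrow> \<phi> x \<le> C * norm x powr (- l)"
  shows "gamma_converges (P2 :: (real ^ 'd) measure set) d_W
           (\<lambda>\<epsilon>. energy (mollified_kernel \<phi> (interaction_kernel p q) \<epsilon>))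
           (energy (interaction_kernel p q))"
proof -
  \<comment> \<open>In dimension at least 3 the decay exponent satisfies \<open>l \<ge> 2 d + 1 \<ge> d + 4 > d + q\<close>, as the \<open>q\<close>-th moment requires.\<close>
  have d: "3 \<le> CARD('d)" using assms(1,2) by linarith
  have [measurable]: "\<phi> \<in> borel_measurable borel"
    using assms(8) by (auto simp: has_bochner_integral_iff)
  have mass: "(\<integral>\<^sup>+x. ennreal (\<phi> x) \<partial>lborel) = 1"
    using assms(7,8) by (subst nn_integral_eq_integral) (auto simp: has_bochner_integral_iff)
  obtain A where A: "A \<ge> 0" "\<And>x. x \<noteq> 0 \<Longrightarrow> \<phi> x \<le> A * norm x powr (- real DIM(real ^ 'd))"
    using continuous_decay_imp_scale_invariant_bound[OF smooth_imp_continuous[OF assms(5)], of "real DIM(real ^ 'd)" l C] assms(9,11)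
    by auto
  define m where "m = enn2real (\<integral>\<^sup>+z. ennreal (norm z powr q) * ennreal (\<phi> z) \<partial>lborel)"
  have "(\<integral>\<^sup>+z. ennreal (norm z powr q) * ennreal (\<phi> z) \<partial>lborel) < \<infinity>"
    by (rule moment_finite[where l=l and C=C]) (use assms mass d in auto)
  then have m: "(\<integral>\<^sup>+z. ennreal (norm z powr q) * ennreal (\<phi> z) \<partial>lborel) = ennreal m" "m \<ge> 0"
    by (simp_all add: m_def)
  define g where "g \<epsilon> x = ennreal (rescale \<phi> \<epsilon> x)" for \<epsilon> x
  define \<psi> where "\<psi> \<epsilon> = nn_convolution (g \<epsilon>) (g \<epsilon>)" for \<epsilon>
  have g [measurable]: "g \<epsilon> \<in> borel_measurable borel" for \<epsilon>
    unfolding g_def[abs_def] rescale_def[abs_def] by measurable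
  have \<psi>: "\<psi> \<epsilon> \<in> borel_measurable borel" for \<epsilon> unfolding \<psi>_def by measurable
  have g_mass: "(\<integral>\<^sup>+x. g \<epsilon> x \<partial>lborel) = 1" if "\<epsilon> > 0" for \<epsilon>
    using nn_integral_rescale[of \<phi> "\<lambda>_. 1" \<epsilon>] assms(7) that mass by (simp add: g_def)
  have \<psi>_mass: "(\<integral>\<^sup>+w. \<psi> \<epsilon> w \<partial>lborel) = 1" if "\<epsilon> > 0" for \<epsilon>
    unfolding \<psi>_def using g g_mass[OF that] by (rule nn_integral_nn_convolution_self)
  define A' where "A' = 2 * 2 powr real DIM(real ^ 'd) * A"
  have \<psi>_le: "\<psi> \<epsilon> w \<le> ennreal (A' * norm w powr (- real DIM(real ^ 'd)))" if "\<epsilon> > 0" "w \<noteq> 0" for \<epsilon> w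
    unfolding \<psi>_def A'_def
    by (rule nn_convolution_self_le)
       (use A that g_mass in \<open>auto simp: g_def intro!: ennreal_leI rescale_le simp del: DIM_cart\<close>)
  define b where "b = 2 * 2 powr q * m"
  have \<psi>_moment: "(\<integral>\<^sup>+w. ennreal (norm w powr q) * \<psi> \<epsilon> w \<partial>lborel) \<le> ennreal (b * \<epsilon> powr q)" if "\<epsilon> > 0" for \<epsilon>
  proof -
    have "(\<integral>\<^sup>+w. ennreal (norm w powr q) * \<psi> \<epsilon> w \<partial>lborel) \<le>
        ennreal (2 * 2 powr q) * (\<integral>\<^sup>+z. ennreal (norm z powr q) * g \<epsilon> z \<partial>lborel)"
      unfolding \<psi>_def using assms(3) g_mass[OF that] by (intro moment_nn_convolution_self_le) auto
    also have "(\<integral>\<^sup>+z. ennreal (norm z powr q) * g \<epsilon> z \<partial>lborel) =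
        (\<integral>\<^sup>+z. ennreal (\<epsilon> powr q) * (ennreal (norm z powr q) * ennreal (\<phi> z)) \<partial>lborel)"
      unfolding g_def using that assms(7)
      by (subst nn_integral_rescale) (auto simp: powr_mult ennreal_mult mult.assoc)
    also have "\<dots> = ennreal (\<epsilon> powr q) * ennreal m" by (simp add: nn_integral_cmult m)
    also have "ennreal (2 * 2 powr q) * (ennreal (\<epsilon> powr q) * ennreal m) = ennreal (b * \<epsilon> powr q)"
      using \<open>m \<ge> 0\<close> by (simp add: b_def ennreal_mult[symmetric] ac_simps)
    finally show ?thesis .
  qed
  have kernel: "mollified_kernel \<phi> (interaction_kernel p q) \<epsilon> = (\<lambda>x. \<integral>\<^sup>+w. interaction_kernel p q (x - w) * \<psi> \<epsilon> w \<partial>lborel)" for \<epsilon>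
    unfolding \<psi>_def g_def by (intro ext mollified_kernel_eq) measurable
  have moment_lim: "((\<lambda>\<epsilon>. \<integral>\<^sup>+w. ennreal (norm w powr q) * \<psi> \<epsilon> w \<partial>lborel) \<longlongrightarrow> 0) (at_right 0)"
  proof (rule tendsto_sandwich[where f="\<lambda>_. 0"])
    show "\<forall>\<^sub>F \<epsilon> in at_right 0. (\<integral>\<^sup>+w. ennreal (norm w powr q) * \<psi> \<epsilon> w \<partial>lborel) \<le> ennreal (b * \<epsilon> powr q)"
      using eventually_at_right_less[of 0] \<psi>_moment by (auto elim: eventually_mono)
    have "((\<lambda>\<epsilon>. b * \<epsilon> powr q) \<longlongrightarrow> b * 0) (at_right 0)"
      using \<open>0 < q\<close> eventually_at_right_less[of "0::real"]
      by (intro tendsto_mult tendsto_zero_powrI[where b=q] tendsto_intros) (auto elim: eventually_mono)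
    then show "((\<lambda>\<epsilon>. ennreal (b * \<epsilon> powr q)) \<longlongrightarrow> 0) (at_right 0)"
      using tendsto_ennrealI by fastforce
  qed auto
  have liminf: "energy (interaction_kernel p q) \<mu> \<le>
      Liminf (at_right 0) (\<lambda>\<epsilon>. energy (mollified_kernel \<phi> (interaction_kernel p q) \<epsilon>) (u \<epsilon>))"
    if "\<And>\<epsilon>. \<epsilon> > 0 \<Longrightarrow> u \<epsilon> \<in> P2" "\<mu> \<in> P2" "((\<lambda>\<epsilon>. d_W (u \<epsilon>) \<mu>) \<longlongrightarrow> 0) (at_right 0)" for u and \<mu> :: "(real ^ 'd) measure"
    unfolding kernel by (rule energy_liminf[OF \<open>p < 0\<close> \<open>0 < q\<close> \<psi> \<psi>_mass moment_lim that])
  have recovery: "((\<lambda>\<epsilon>. energy (mollified_kernel \<phi> (interaction_kernel p q) \<epsilon>) \<mu>) \<longlongrightarrow> energy (interaction_kernel p q) \<mu>) (at_right 0)"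
    if \<mu>: "\<mu> \<in> P2" for \<mu> :: "(real ^ 'd) measure"
  proof (rule order_tendstoI)
    fix a assume "a < energy (interaction_kernel p q) \<mu>"
    also have "\<dots> \<le> Liminf (at_right 0) (\<lambda>\<epsilon>. energy (mollified_kernel \<phi> (interaction_kernel p q) \<epsilon>) \<mu>)"
      using \<mu> by (intro liminf) (auto simp: d_W_def wasserstein_cost_self)
    finally show "\<forall>\<^sub>F \<epsilon> in at_right 0. a < energy (mollified_kernel \<phi> (interaction_kernel p q) \<epsilon>) \<mu>"
      by (rule less_LiminfD)
  next
    fix a assume "energy (interaction_kernel p q) \<mu> < a"
    moreover have "- real DIM(real ^ 'd) < p" using assms(1) by simp
    moreover have "A' \<ge> 0" "b \<ge> 0" using A m by (simp_all add: A'_def b_def)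
    moreover have "sets \<mu> = sets borel" "prob_space \<mu>" using \<mu> by (auto simp: P2_def)
    ultimately show "\<forall>\<^sub>F \<epsilon> in at_right 0. energy (mollified_kernel \<phi> (interaction_kernel p q) \<epsilon>) \<mu> < a"
      unfolding kernel using assms(2,3) \<psi> \<psi>_mass \<psi>_le \<psi>_moment
      by (intro energy_limsup[where A=A' and b=b])
  qed
  show ?thesis
    unfolding gamma_converges_def
  proof (intro conjI allI impI ballI)
    fix u :: "real \<Rightarrow> (real ^ 'd) measure" and x :: "(real ^ 'd) measure"
    assume "\<forall>\<epsilon>>0. u \<epsilon> \<in> P2" "x \<in> P2" "((\<lambda>\<epsilon>. d_W (u \<epsilon>) x) \<longlongrightarrow> 0) (at_right 0)"
    then show "energy (interaction_kernel p q) x \<le>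
        Liminf (at_right 0) (\<lambda>\<epsilon>. energy (mollified_kernel \<phi> (interaction_kernel p q) \<epsilon>) (u \<epsilon>))"
      by (intro liminf) auto
  next
    fix x :: "(real ^ 'd) measure" assume "x \<in> P2"
    then show "\<exists>u. (\<forall>\<epsilon>>0. u \<epsilon> \<in> P2) \<and> ((\<lambda>\<epsilon>. d_W (u \<epsilon>) x) \<longlongrightarrow> 0) (at_right 0) \<and>
        ((\<lambda>\<epsilon>. energy (mollified_kernel \<phi> (interaction_kernel p q) \<epsilon>) (u \<epsilon>)) \<longlongrightarrow> energy (interaction_kernel p q) x) (at_right 0)"
      by (intro exI[of _ "\<lambda>_. x"]) (auto simp: recovery d_W_def wasserstein_cost_self)
  qed
qed

end
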